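(* Let $d\ge 1$, let $A,B$ be standard Borel spaces, let $X=(X_i)_{i\in\mathbb{Z}^d}$ be an i.i.d. $A$-valued random field, and let $Y=\varphi(X)$ for some finitary coding $\varphi:A^{\mathbb{Z}^d}\to B^{\mathbb{Z}^d}$ (finitary with respect to the law of $X$). Assume that the coding volume has a finite second moment, i.e. $$\mathbb{E}\big[|B_\infty(0,r_\varphi(X))|^2\big]<\infty .$$ Then, for every local and continuous $f:B^{\mathbb{Z}^d}\to\mathbb{R}$ with the bounded-difference property, $$\log \mathbb{E}\big[\exp\{\lambda(f(Y)-\mathbb{E} f(Y))\}\big]\le 2^{d}\lambda^2\,\mathbb{E}\big[(2r_\varphi(X)+1)^{2d}\big]\,\|\delta f\|_2^2,\qquad \forall\,\lambda>0 .$$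
   Context: Codings. $T^j$ and $S^j$ ($j\in\mathbb{Z}^d$) denote the shifts $(T^jx)_i=x_{i+j}$ on $A^{\mathbb{Z}^d}$ and $(S^jy)_i=y_{i+j}$ on $B^{\mathbb{Z}^d}$ (product $\sigma$-algebras). $B_\infty(j,r)=\{i\in\mathbb{Z}^d:\|i-j\|_\infty\le r\}$, of cardinality $|B_\infty(j,r)|=(2r+1)^d$. A coding map is a measurable $\varphi:A^{\mathbb{Z}^d}\to B^{\mathbb{Z}^d}$ with $\varphi\circ T^j=S^j\circ\varphi$ for all $j$. Its coding radius at the origin is $$r_\varphi(x)=\inf\{r\in\mathbb{N}_0:\ \forall x'\in A^{\mathbb{Z}^d},\ x'_{B_\infty(0,r)}=x_{B_\infty(0,r)}\Rightarrow\varphi(x')_0=\varphi(x)_0\}$$ ($=\infty$ if the set is empty). $\varphi$ is finitary (with respect to the law of a shift-invariant field $X$) if $r_\varphi(X)<\infty$ almost surely; $Y=\varphi(X)$ is then a finitary coding of $X$, and $|B_\infty(0,r_\varphi(X))|$ is the coding volume. Oscillations. For measurable $f:B^{\mathbb{Z}^d}\to\mathbb{R}$, $\delta_jf=\sup\{|f(y)-f(y')|: y_\ell=y'_\ell\ \forall \ell\ne j\}\in[0,\infty]$, $\mathrm{dep}(f)=\{j:\delta_jf>0\}$. $f$ is local if $\mathrm{dep}(f)$ is finite (and $f$ depends only on the coordinates in $\mathrm{dep}(f)$); it has the bounded-difference property if $\delta_jf<\infty$ for all $j$. $\|\delta f\|_2^2=\sum_j(\delta_jf)^2$. Continuity of $f$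 refers to the product topology on $B^{\mathbb{Z}^d}$, where $B$ carries the (Polish) topology underlying its standard Borel structure (discrete if $B$ is finite). *)

theory Defs
  imports "HOL-Probability.Probability"
begin

definition polish_topology :: "'a topology \<Rightarrow> bool" where
  "polish_topology T \<longleftrightarrow> completely_metrizable_space T \<and> separable_space T"

definition borel_of :: "'a topology \<Rightarrow> 'a measure" where
  "borel_of T = sigma (topspace T) {U. openin T U}"

definition standard_borel :: "'a measure \<Rightarrow> bool" where
  "standard_borel M \<longleftrightarrow>
     (\<exists>T. polish_topology T \<and> space M = topspace T \<and> sets M = sets (borel_of T))"

text \<open>The lattice is \<^typ>\<open>int ^ 'd\<close> with a finite index type \<^typ>\<open>'d\<close>, its dimension
  being \<open>CARD('d) \<ge> 1\<close>.\<close>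

type_synonym ('d, 'a) config = "(int ^ 'd) \<Rightarrow> 'a"

definition configs :: "'a set \<Rightarrow> ('d::finite, 'a) config set" where
  "configs S = (UNIV \<rightarrow> S)"

definition config_space :: "'a measure \<Rightarrow> ('d::finite, 'a) config measure" where
  "config_space MA = Pi\<^sub>M UNIV (\<lambda>_. MA)"

definition shift :: "int ^ 'd::finite \<Rightarrow> ('d, 'a) config \<Rightarrow> ('d, 'a) config" where
  "shift j x = (\<lambda>i. x (i + j))"

definition sup_norm :: "int ^ 'd::finite \<Rightarrow> nat" where
  "sup_norm v = Max (range (\<lambda>k. nat \<bar>v $ k\<bar>))"

text \<open>The radius may be infinite, in which case the ball is the whole lattice.\<close>

definition sup_ball :: "int ^ 'd::finite \<Rightarrow> enat \<Rightarrow> (int ^ 'd) set" where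
  "sup_ball j r = {i. enat (sup_norm (i - j)) \<le> r}"

definition coding_map ::
    "'a measure \<Rightarrow> 'b measure \<Rightarrow> (('d::finite, 'a) config \<Rightarrow> ('d, 'b) config) \<Rightarrow> bool" where
  "coding_map MA MB \<phi> \<longleftrightarrow>
     \<phi> \<in> config_space MA \<rightarrow>\<^sub>M config_space MB \<and>
     (\<forall>j. \<forall>x \<in> configs (space MA). \<phi> (shift j x) = shift j (\<phi> x))"

text \<open>In \<^typ>\<open>enat\<close> the infimum of the empty set is \<open>\<infinity>\<close>.\<close>

definition coding_radius ::
    "'a measure \<Rightarrow> (('d::finite, 'a) config \<Rightarrow> ('d, 'b) config) \<Rightarrow> ('d, 'a) config \<Rightarrow> enat" where
  "coding_radius MA \<phi> x =
     Inf {enat r | r. \<forall>x' \<in> configs (space MA).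
                        (\<forall>i \<in> sup_ball 0 (enat r). x' i = x i) \<longrightarrow> \<phi> x' 0 = \<phi> x 0}"

text \<open>The coding radius of a Borel map need not be Borel; it is universally measurable.  The
  integrals \<open>\<integral>\<^sup>+\<close> of functions of the radius, and \<open>AE\<close> statements about it, agree with
  those for the completed measure (\<open>nn_integral_completion\<close>, \<open>AE_completion_iff\<close>), so no
  measurability assumption is needed.\<close>

definition coding_volume ::
    "'a measure \<Rightarrow> (('d::finite, 'a) config \<Rightarrow> ('d, 'b) config) \<Rightarrow> ('d, 'a) config \<Rightarrow> ennreal" where
  "coding_volume MA \<phi> x = emeasure (count_space UNIV) (sup_ball (0 :: int ^ 'd) (coding_radius MA \<phi> x))"

definition iid_field :: "'w measure \<Rightarrow> 'a measure \<Rightarrow> (int ^ 'd::finite \<Rightarrow> 'w \<Rightarrow> 'a) \<Rightarrow> bool" where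
  "iid_field M MA X \<longleftrightarrow>
     prob_space M \<and> prob_space.indep_vars M (\<lambda>_. MA) X UNIV \<and>
     (\<forall>i j. distr M MA (X i) = distr M MA (X j))"

definition realization :: "(int ^ 'd::finite \<Rightarrow> 'w \<Rightarrow> 'a) \<Rightarrow> 'w \<Rightarrow> ('d, 'a) config" where
  "realization X \<omega> = (\<lambda>i. X i \<omega>)"

definition finitary ::
    "'w measure \<Rightarrow> 'a measure \<Rightarrow> (int ^ 'd::finite \<Rightarrow> 'w \<Rightarrow> 'a)
       \<Rightarrow> (('d, 'a) config \<Rightarrow> ('d, 'b) config) \<Rightarrow> bool" where
  "finitary M MA X \<phi> \<longleftrightarrow> (AE \<omega> in M. coding_radius MA \<phi> (realization X \<omega>) < \<infinity>)"

definition osc :: "'b set \<Rightarrow> (('d::finite, 'b) config \<Rightarrow> real) \<Rightarrow> int ^ 'd \<Rightarrow> ennreal" where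
  "osc S f j = Sup {ennreal \<bar>f y - f y'\<bar> | y y'.
     y \<in> configs S \<and> y' \<in> configs S \<and> (\<forall>l. l \<noteq> j \<longrightarrow> y l = y' l)}"

definition dep :: "'b set \<Rightarrow> (('d::finite, 'b) config \<Rightarrow> real) \<Rightarrow> (int ^ 'd) set" where
  "dep S f = {j. osc S f j > 0}"

definition local_fun :: "'b set \<Rightarrow> (('d::finite, 'b) config \<Rightarrow> real) \<Rightarrow> bool" where
  "local_fun S f \<longleftrightarrow> finite (dep S f) \<and>
     (\<forall>y \<in> configs S. \<forall>y' \<in> configs S. (\<forall>j \<in> dep S f. y j = y' j) \<longrightarrow> f y = f y')"

definition bounded_differences :: "'b set \<Rightarrow> (('d::finite, 'b) config \<Rightarrow> real) \<Rightarrow> bool" where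
  "bounded_differences S f \<longleftrightarrow> (\<forall>j. osc S f j < \<infinity>)"

definition osc_norm_sq :: "'b set \<Rightarrow> (('d::finite, 'b) config \<Rightarrow> real) \<Rightarrow> ennreal" where
  "osc_norm_sq S f = (\<Sum>\<^sub>\<infinity>j. (osc S f j)\<^sup>2)"

end

(*
  If g y <= g x + (sum of c_i(x) over the i with x_i ~= y_i) for all x and y, then the product
  measure satisfies ln E exp(g - E g) <= (sum_i E c_i^2) / 2, with the mean rather than the
  supremum of sum_i c_i^2 (Talagrand, Marton).  Induction on the coordinates proves the form in
  which g x on the right is replaced by an unrelated function b x, because integrating out one
  coordinate destroys the relation between the two; the one-dimensional case is
  ln E exp(F - m) <= E exp(F - m) - 1 with m = sup F.

  For g = l * f(phi x) one takes c_i(x) = l * (sum of delta_j f over the j with |i - j| <= r_j(x)).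
  Two balls of radii r <= s around j and k meet only if |j - k| <= 2 s, so by stationarity
  sum_i E c_i^2 <= 2 * 2^d * l^2 * E (2 r + 1)^(2 d) * |delta f|_2^2.

  The coding radius need not be measurable and the integral in the bound is a lower integral.
  It is replaced by a smaller measurable radius, the least r for which resampling everything
  outside the ball of radius r almost surely leaves phi(x)_0 unchanged.  Truncated at n, this radius
  and the value it determines are functions of finitely many coordinates, and n tends to infinity.
*)
theory Submission
  imports Defs
begin

section \<open>The Talagrand--Marton inequality for product measures\<close>

text \<open>Let m be the supremum of \<open>F\<close>. Taking s = t in \<open>le\<close> gives F <=
  B, and the supremum over s gives m <= B + C. Then ln E exp(F - m) <= E exp(F - m) - 1 reduces the
  claim to a pointwise estimate in the gap m - B, which is at most C.\<close>

lemma (in prob_space) ln_exp_integral_le: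
  fixes F B C :: "'a \<Rightarrow> real"
  assumes [measurable]: "F \<in> borel_measurable M" "B \<in> borel_measurable M" "C \<in> borel_measurable M"
    and bF: "\<And>t. t \<in> space M \<Longrightarrow> \<bar>F t\<bar> \<le> k" and bB: "\<And>t. t \<in> space M \<Longrightarrow> \<bar>B t\<bar> \<le> k"
    and bC: "\<And>t. t \<in> space M \<Longrightarrow> \<bar>C t\<bar> \<le> k"
    and nonneg: "\<And>t. t \<in> space M \<Longrightarrow> 0 \<le> C t"
    and le: "\<And>s t. s \<in> space M \<Longrightarrow> t \<in> space M \<Longrightarrow> F s \<le> B t + (if t = s then 0 else C t)"
  shows "ln (\<integral>t. exp (F t) \<partial>M) \<le> (\<integral>t. B t + (C t)\<^sup>2 / 2 \<partial>M)"
proof -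
  define m where "m = Sup (F ` space M)"
  have bdd: "bdd_above (F ` space M)" using bF by (auto intro!: bdd_aboveI[of _ k] dest: abs_le_D1)
  have ne: "space M \<noteq> {}" using not_empty .
  have Fm: "F t \<le> m" if "t \<in> space M" for t
    unfolding m_def using that bdd by (auto intro: cSup_upper)
  have mle: "m \<le> B t + C t" if t: "t \<in> space M" for t
    unfolding m_def
  proof (intro cSup_least)
    fix v assume "v \<in> F ` space M"
    then obtain s where "v = F s" "s \<in> space M" by blast
    then show "v \<le> B t + C t"
      using le[OF _ t, of s] nonneg[OF t] by (simp split: if_splits)
  qed (use ne in simp)
  \<comment> \<open>For m <= B the exponential is at most 1. Otherwise b = m - B is positive, exp(F
    - m) <= exp(-b), and in m + (1 - b + b^2 / 2) - 1 the first two terms combine to B.\<close>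
  have ptw: "m + (exp (F t - m) - 1) \<le> B t + (C t)\<^sup>2 / 2" if t: "t \<in> space M" for t
  proof -
    have FB: "F t \<le> B t" using le[OF t t] by simp
    show ?thesis
    proof (cases "m \<le> B t")
      case True
      have "exp (F t - m) \<le> 1" using Fm[OF t] by simp
      then show ?thesis using True zero_le_power2[of "C t"] by linarith
    next
      case False
      define b where "b = m - B t"
      have b: "b > 0" "b \<le> C t" using False mle[OF t] by (auto simp: b_def)
      have "exp (F t - m) \<le> exp (- b)" using FB by (simp add: b_def)
      also have "\<dots> \<le> 1 - b + b\<^sup>2 / 2"
      proof -
        \<comment> \<open>The Lagrange remainder of order three has the sign of (-b)^3, so dropping
          it gives an upper bound.\<close>
        obtain u where u: "exp (-b) = (\<Sum>i<3. (-b)^i / fact i) + exp u / fact 3 * (-b)^3"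
          using Maclaurin_exp_le[of "-b" 3] by auto
        have "exp u / fact 3 * (-b)^3 \<le> 0" using b by (simp add: mult_nonneg_nonpos)
        then show ?thesis using u by (simp add: eval_nat_numeral)
      qed
      also have "b\<^sup>2 \<le> (C t)\<^sup>2" using b by (intro power_mono) auto
      finally show ?thesis by (simp add: b_def)
    qed
  qed
  have iF: "integrable M (\<lambda>t. exp (F t - m))"
    by (rule integrable_const_bound[where B = 1]) (use Fm in auto)
  have iB: "integrable M (\<lambda>t. B t + (C t)\<^sup>2 / 2)"
  proof (intro Bochner_Integration.integrable_add integrable_divide_zero)
    show "integrable M B" by (rule integrable_const_bound[where B = k]) (use bB in auto)
    have "(C t)\<^sup>2 \<le> k\<^sup>2" if "t \<in> space M" for t
      using bC[OF that] by (metis abs_ge_zero power2_abs power_mono)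
    then show "integrable M (\<lambda>t. (C t)\<^sup>2)"
      by (intro integrable_const_bound[where B = "k\<^sup>2"]) auto
  qed
  have pos: "0 < (\<integral>t. exp (F t - m) \<partial>M)"
  proof -
    have "exp (- k - m) = (\<integral>t. exp (- k - m) \<partial>M)" by (simp add: prob_space)
    also have "\<dots> \<le> (\<integral>t. exp (F t - m) \<partial>M)"
      using iF bF[THEN abs_le_D2] by (intro integral_mono) (auto simp: minus_le_iff)
    finally show ?thesis using exp_gt_zero[of "- k - m"] by linarith
  qed
  have "(\<integral>t. exp (F t) \<partial>M) = exp m * (\<integral>t. exp (F t - m) \<partial>M)"
    by (subst integral_mult_right_zero[symmetric]) (simp add: exp_diff)
  then have "ln (\<integral>t. exp (F t) \<partial>M) = m + ln (\<integral>t. exp (F t - m) \<partial>M)"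
    using pos by (simp add: ln_mult)
  also have "\<dots> \<le> m + ((\<integral>t. exp (F t - m) \<partial>M) - 1)"
    using ln_le_minus_one[OF pos] by simp
  also have "\<dots> = (\<integral>t. m + (exp (F t - m) - 1) \<partial>M)"
    using iF by (simp add: prob_space)
  also have "\<dots> \<le> (\<integral>t. B t + (C t)\<^sup>2 / 2 \<partial>M)"
    using iF iB ptw by (intro integral_mono) auto
  finally show ?thesis .
qed


text \<open>Nonnegativity of the variance. It keeps the squared mean of an influence below its mean
  square when a coordinate is integrated out.\<close>

lemma (in prob_space) power2_integral_le:
  fixes X :: "'a \<Rightarrow> real"
  assumes [measurable]: "X \<in> borel_measurable M" and bX: "\<And>t. t \<in> space M \<Longrightarrow> \<bar>X t\<bar> \<le> k"
  shows "(\<integral>t. X t \<partial>M)\<^sup>2 \<le> (\<integral>t. (X t)\<^sup>2 \<partial>M)"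
proof -
  have "integrable M X" by (rule integrable_const_bound[where B = k]) (use bX in auto)
  moreover have "(X t)\<^sup>2 \<le> k\<^sup>2" if "t \<in> space M" for t
    using bX[OF that] by (metis abs_ge_zero power2_abs power_mono)
  then have "integrable M (\<lambda>t. (X t)\<^sup>2)"
    by (intro integrable_const_bound[where B = "k\<^sup>2"]) auto
  ultimately show ?thesis using variance_eq[of X] variance_positive[of X] by simp
qed

lemma (in prob_space) abs_integral_le_const:
  fixes X :: "'a \<Rightarrow> real"
  assumes [measurable]: "X \<in> borel_measurable M" and bX: "\<And>t. t \<in> space M \<Longrightarrow> \<bar>X t\<bar> \<le> k"
  shows "\<bar>\<integral>t. X t \<partial>M\<bar> \<le> k"
proof -
  have "integrable M X" by (rule integrable_const_bound[where B = k]) (use bX in auto)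
  then have "\<bar>\<integral>t. X t \<partial>M\<bar> \<le> (\<integral>t. \<bar>X t\<bar> \<partial>M)" by simp
  also have "\<dots> \<le> (\<integral>t. k \<partial>M)" using \<open>integrable M X\<close> bX by (intro integral_mono) auto
  finally show ?thesis by (simp add: prob_space)
qed

lemma (in prob_space) ln_exp_integral_bounds:
  fixes X :: "'a \<Rightarrow> real"
  assumes [measurable]: "X \<in> borel_measurable M" and bX: "\<And>t. t \<in> space M \<Longrightarrow> \<bar>X t\<bar> \<le> k"
  shows "0 < (\<integral>t. exp (X t) \<partial>M)" and "\<bar>ln (\<integral>t. exp (X t) \<partial>M)\<bar> \<le> k"
proof -
  have int: "integrable M (\<lambda>t. exp (X t))"
    by (rule integrable_const_bound[where B = "exp k"]) (use bX[THEN abs_le_D1] in auto)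
  have "(\<integral>t. exp (- k) \<partial>M) \<le> (\<integral>t. exp (X t) \<partial>M)"
    using int bX[THEN abs_le_D2] by (intro integral_mono) (auto simp: minus_le_iff)
  then have lo: "exp (- k) \<le> (\<integral>t. exp (X t) \<partial>M)" by (simp add: prob_space)
  have "(\<integral>t. exp (X t) \<partial>M) \<le> (\<integral>t. exp k \<partial>M)"
    using int bX[THEN abs_le_D1] by (intro integral_mono) auto
  then have hi: "(\<integral>t. exp (X t) \<partial>M) \<le> exp k" by (simp add: prob_space)
  show pos: "0 < (\<integral>t. exp (X t) \<partial>M)" using lo exp_gt_zero[of "- k"] by linarith
  show "\<bar>ln (\<integral>t. exp (X t) \<partial>M)\<bar> \<le> k"
    using ln_ge_iff[OF pos, of "- k"] lo ln_mono[OF hi pos] by (simp add: abs_le_iff)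
qed

text \<open>Integrating out \<open>i\<close> turns \<open>f\<close> into its log-Laplace transform
  in that coordinate, adds half of c_i^2 to \<open>b\<close> before averaging, and averages every
  other c_j. The one-coordinate lemma shows that the new triple satisfies the same hypothesis. The
  uniform bound \<open>k\<close> serves integrability and changes along the induction, so it is
  generalized.\<close>

lemma ln_exp_integral_PiM_le:
  fixes f b :: "('i \<Rightarrow> 'a) \<Rightarrow> real" and c :: "'i \<Rightarrow> ('i \<Rightarrow> 'a) \<Rightarrow> real"
  assumes "finite I" and M: "\<And>i. prob_space (M i)"
    and "f \<in> borel_measurable (PiM I M)" "b \<in> borel_measurable (PiM I M)"
    and "\<And>i. i \<in> I \<Longrightarrow> c i \<in> borel_measurable (PiM I M)"
    and "\<And>x. x \<in> space (PiM I M) \<Longrightarrow> \<bar>f x\<bar> \<le> k" "\<And>x. x \<in> space (PiM I M) \<Longrightarrow> \<bar>b x\<bar> \<le> k"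
    and "\<And>i x. i \<in> I \<Longrightarrow> x \<in> space (PiM I M) \<Longrightarrow> 0 \<le> c i x"
    and "\<And>i x. i \<in> I \<Longrightarrow> x \<in> space (PiM I M) \<Longrightarrow> c i x \<le> k"
    and "\<And>x y. x \<in> space (PiM I M) \<Longrightarrow> y \<in> space (PiM I M) \<Longrightarrow>
           f y \<le> b x + (\<Sum>i\<in>I. if x i = y i then 0 else c i x)"
  shows "ln (\<integral>x. exp (f x) \<partial>PiM I M) \<le> (\<integral>x. b x + (\<Sum>i\<in>I. (c i x)\<^sup>2) / 2 \<partial>PiM I M)"
  using assms(1,3-)
proof (induction I arbitrary: f b c k rule: finite_induct)
  case empty
  interpret prob_space "PiM {} M" by (rule prob_space_PiM) (rule M)
  show ?case
    using ln_exp_integral_le[of f b "\<lambda>_. 0" k] empty.prems by (auto simp: space_PiM)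
next
  case (insert i I)
  interpret M: prob_space "M j" for j by (rule M)
  interpret PS: product_sigma_finite M by unfold_locales
  interpret P: prob_space "PiM I M" by (rule prob_space_PiM) (rule M)
  interpret Q: prob_space "PiM (insert i I) M" by (rule prob_space_PiM) (rule M)
  obtain x0 where "x0 \<in> space (PiM (insert i I) M)" using Q.not_empty by blast
  from insert.prems(4)[OF this] have k: "0 \<le> k" by simp
  define u :: "('i \<Rightarrow> 'a) \<Rightarrow> 'a \<Rightarrow> 'i \<Rightarrow> 'a" where "u x t = x(i := t)" for x t
  have upd: "(\<lambda>(x, t). u x t) \<in> PiM I M \<Otimes>\<^sub>M M i \<rightarrow>\<^sub>M PiM (insert i I) M"
    using measurable_add_dim[of i I M] by (simp add: u_def)
  have upd1: "(\<lambda>t. u x t) \<in> M i \<rightarrow>\<^sub>M PiM (insert i I) M" if "x \<in> space (PiM I M)" for x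
    using measurable_Pair2[OF upd that] by simp
  note [measurable] = insert.prems(1-3)
  have sp: "u x t \<in> space (PiM (insert i I) M)" if "x \<in> space (PiM I M)" "t \<in> space (M i)" for x t
    using that by (auto simp: u_def space_PiM PiE_iff extensional_def)
  note bds = insert.prems(6,7)[OF _ sp] insert.prems(4,5)[OF sp]
  have meas2: "(\<lambda>(x, t). h (u x t)) \<in> borel_measurable (PiM I M \<Otimes>\<^sub>M M i)"
    if "h \<in> borel_measurable (PiM (insert i I) M)" for h :: "('i \<Rightarrow> 'a) \<Rightarrow> real"
    using measurable_compose[OF upd that] by (simp add: case_prod_beta')
  have meas1: "(\<lambda>t. h (u x t)) \<in> borel_measurable (M i)"
    if "x \<in> space (PiM I M)" "h \<in> borel_measurable (PiM (insert i I) M)"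
    for h :: "('i \<Rightarrow> 'a) \<Rightarrow> real" and x
    using measurable_compose[OF upd1[OF that(1)] that(2)] .
  have meas: "(\<lambda>x. \<integral>t. h (u x t) \<partial>M i) \<in> borel_measurable (PiM I M)"
    if "h \<in> borel_measurable (PiM (insert i I) M)" for h :: "('i \<Rightarrow> 'a) \<Rightarrow> real"
    using M.borel_measurable_lebesgue_integral[of "\<lambda>x t. h (u x t)"] meas2[OF that] by simp
  define F where "F x = ln (\<integral>t. exp (f (u x t)) \<partial>M i)" for x
  define b' where "b' x = (\<integral>t. b (u x t) + (c i (u x t))\<^sup>2 / 2 \<partial>M i)" for x
  define c' where "c' j x = (\<integral>t. c j (u x t) \<partial>M i)" for j x
  have F_meas: "F \<in> borel_measurable (PiM I M)"
    unfolding F_def by (intro borel_measurable_ln meas[of "\<lambda>x. exp (f x)"]) measurable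
  have b_meas: "b' \<in> borel_measurable (PiM I M)"
    unfolding b'_def by (intro meas[of "\<lambda>x. b x + (c i x)\<^sup>2 / 2"]) measurable
  have c_meas: "c' j \<in> borel_measurable (PiM I M)" if "j \<in> I" for j
    unfolding c'_def using that by (intro meas) measurable
  have F_bd: "\<bar>F x\<bar> \<le> k" if "x \<in> space (PiM I M)" for x
    unfolding F_def using that by (intro M.ln_exp_integral_bounds meas1 bds) auto
  have csq: "(c j x)\<^sup>2 \<le> k\<^sup>2" if "x \<in> space (PiM (insert i I) M)" "j \<in> insert i I" for x j
    using insert.prems(6,7)[OF that(2,1)] by (intro power_mono)
  have b_bd: "\<bar>b' x\<bar> \<le> k + k\<^sup>2" if "x \<in> space (PiM I M)" for x
    unfolding b'_def
  proof (intro M.abs_integral_le_const)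
    show "(\<lambda>t. b (u x t) + (c i (u x t))\<^sup>2 / 2) \<in> borel_measurable (M i)"
      using that by (intro meas1[of _ "\<lambda>x. b x + (c i x)\<^sup>2 / 2"]) measurable
    show "\<bar>b (u x t) + (c i (u x t))\<^sup>2 / 2\<bar> \<le> k + k\<^sup>2" if t: "t \<in> space (M i)" for t
      using insert.prems(5)[OF sp[OF \<open>x \<in> _\<close> t]] csq[OF sp[OF \<open>x \<in> _\<close> t] insertI1]
        zero_le_power2[of "c i (u x t)"] by linarith
  qed
  have c_nonneg: "0 \<le> c' j x" if "j \<in> I" "x \<in> space (PiM I M)" for j x
    unfolding c'_def using that by (intro integral_nonneg_AE AE_I2 insert.prems(6)[OF _ sp]) auto
  have c_le: "c' j x \<le> k" if "j \<in> I" "x \<in> space (PiM I M)" for j x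
  proof -
    have "\<bar>c' j x\<bar> \<le> k" unfolding c'_def using that insert.prems(6,7)[OF _ sp, of j x]
      by (intro M.abs_integral_le_const meas1) auto
    then show ?thesis by simp
  qed
  have int_c: "integrable (M i) (\<lambda>t. c j (u x t))" if "j \<in> insert i I" "x \<in> space (PiM I M)" for j x
    using that insert.prems(6,7)[OF that(1) sp[OF that(2)]]
    by (intro M.integrable_const_bound[where B = k] meas1) auto
  have int_csq: "integrable (M i) (\<lambda>t. (c j (u x t))\<^sup>2)"
    if "j \<in> insert i I" "x \<in> space (PiM I M)" for j x
    using that csq[OF sp[OF that(2)] that(1)]
    by (intro M.integrable_const_bound[where B = "k\<^sup>2"] meas1[of _ "\<lambda>x. (c j x)\<^sup>2"]) auto
  have int_b: "integrable (M i) (\<lambda>t. b (u x t))" if "x \<in> space (PiM I M)" for x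
    using that insert.prems(5)[OF sp[OF that]]
    by (intro M.integrable_const_bound[where B = k] meas1) auto
  \<comment> \<open>For fixed \<open>x\<close> and \<open>y\<close> the one-coordinate lemma is
    applied with s the value at \<open>i\<close> next to \<open>y\<close> and t the value at
    \<open>i\<close> next to \<open>x\<close>. \<open>B\<close> collects \<open>b\<close> and the
    costs of the other coordinates, which depend on t but not on s.\<close>
  have F_le: "F y \<le> b' x + (\<Sum>j\<in>I. if x j = y j then 0 else c' j x)"
    if x: "x \<in> space (PiM I M)" and y: "y \<in> space (PiM I M)" for x y
  proof -
    define B where "B t = b (u x t) + (\<Sum>j\<in>I. if x j = y j then 0 else c j (u x t))" for t
    have int_if: "integrable (M i) (\<lambda>t. if x j = y j then 0 else c j (u x t))" if "j \<in> I" for j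
      using int_c[OF _ x, of j] that by (cases "x j = y j") auto
    have "F y \<le> (\<integral>t. B t + (c i (u x t))\<^sup>2 / 2 \<partial>M i)"
      unfolding F_def
    proof (rule M.ln_exp_integral_le[where k = "k + card I * k"])
      show "(\<lambda>t. f (u y t)) \<in> borel_measurable (M i)" using y by (intro meas1) auto
      have [measurable]: "(\<lambda>t. b (u x t)) \<in> borel_measurable (M i)"
        "\<And>j. j \<in> insert i I \<Longrightarrow> (\<lambda>t. c j (u x t)) \<in> borel_measurable (M i)"
        using x by (auto intro!: meas1)
      show "(\<lambda>t. c i (u x t)) \<in> borel_measurable (M i)" by simp
      show "B \<in> borel_measurable (M i)" unfolding B_def by measurable
      fix t assume t: "t \<in> space (M i)"
      have ck: "0 \<le> card I * k" using k by simp
      show "\<bar>f (u y t)\<bar> \<le> k + card I * k" using insert.prems(4)[OF sp[OF y t]] ck by linarith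
      show "0 \<le> c i (u x t)" using insert.prems(6)[OF _ sp[OF x t]] by simp
      then show "\<bar>c i (u x t)\<bar> \<le> k + card I * k" using insert.prems(7)[OF insertI1 sp[OF x t]] ck by linarith
      have "0 \<le> (\<Sum>j\<in>I. if x j = y j then 0 else c j (u x t))"
        using insert.prems(6)[OF _ sp[OF x t]] by (intro sum_nonneg) auto
      moreover have "(\<Sum>j\<in>I. if x j = y j then 0 else c j (u x t)) \<le> card I * k"
        using insert.prems(7)[OF _ sp[OF x t]] k by (intro sum_bounded_above) auto
      ultimately show "\<bar>B t\<bar> \<le> k + card I * k"
        using insert.prems(5)[OF sp[OF x t]] unfolding B_def by linarith
      fix s assume s: "s \<in> space (M i)"
      have "(\<Sum>j\<in>I. if u x t j = u y s j then 0 else c j (u x t))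
          = (\<Sum>j\<in>I. if x j = y j then 0 else c j (u x t))"
        using insert.hyps by (intro sum.cong) (auto simp: u_def)
      moreover have "f (u y s) \<le> b (u x t) + (\<Sum>j\<in>insert i I. if u x t j = u y s j then 0 else c j (u x t))"
        by (rule insert.prems(8)[OF sp[OF x t] sp[OF y s]])
      moreover have "u x t i = t" "u y s i = s" by (simp_all add: u_def)
      ultimately show "f (u y s) \<le> B t + (if t = s then 0 else c i (u x t))"
        using insert.hyps by (simp add: B_def)
    qed
    also have "\<dots> = (\<integral>t. (b (u x t) + (c i (u x t))\<^sup>2 / 2)
        + (\<Sum>j\<in>I. if x j = y j then 0 else c j (u x t)) \<partial>M i)"
      by (simp add: B_def algebra_simps)
    also have "\<dots> = b' x + (\<integral>t. (\<Sum>j\<in>I. if x j = y j then 0 else c j (u x t)) \<partial>M i)"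
      unfolding b'_def using int_b[OF x] int_csq[OF _ x] int_if
      by (intro Bochner_Integration.integral_add Bochner_Integration.integrable_add
          Bochner_Integration.integrable_sum integrable_divide_zero) auto
    also have "(\<integral>t. (\<Sum>j\<in>I. if x j = y j then 0 else c j (u x t)) \<partial>M i)
        = (\<Sum>j\<in>I. if x j = y j then 0 else c' j x)"
      unfolding c'_def using int_if
      by (subst Bochner_Integration.integral_sum) (auto intro!: sum.cong)
    finally show ?thesis .
  qed
  let ?G = "\<lambda>x. b x + (\<Sum>j\<in>insert i I. (c j x)\<^sup>2) / 2"
  have G_meas[measurable]: "?G \<in> borel_measurable (PiM (insert i I) M)" by measurable
  have G_bd: "\<bar>?G x\<bar> \<le> k + card (insert i I) * k\<^sup>2" if "x \<in> space (PiM (insert i I) M)" for x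
  proof -
    have "0 \<le> (\<Sum>j\<in>insert i I. (c j x)\<^sup>2)" by (intro sum_nonneg) auto
    moreover have "(\<Sum>j\<in>insert i I. (c j x)\<^sup>2) \<le> card (insert i I) * k\<^sup>2"
      using csq[OF that] by (intro sum_bounded_above) auto
    ultimately show ?thesis using insert.prems(5)[OF that] by linarith
  qed
  have "(\<integral>x. exp (f x) \<partial>PiM (insert i I) M) = (\<integral>x. \<integral>t. exp (f (u x t)) \<partial>M i \<partial>PiM I M)"
    unfolding u_def using insert.hyps insert.prems(4)
    by (intro PS.product_integral_insert Q.integrable_const_bound[where B = "exp k"]) (auto dest: abs_le_D1)
  also have "\<dots> = (\<integral>x. exp (F x) \<partial>PiM I M)"
    unfolding F_def
    by (intro Bochner_Integration.integral_cong refl exp_ln[symmetric] M.ln_exp_integral_bounds(1)[where k = k] meas1 bds) auto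
  finally have "ln (\<integral>x. exp (f x) \<partial>PiM (insert i I) M) = ln (\<integral>x. exp (F x) \<partial>PiM I M)" by simp
  also have "\<dots> \<le> (\<integral>x. b' x + (\<Sum>j\<in>I. (c' j x)\<^sup>2) / 2 \<partial>PiM I M)"
  \<comment> \<open>The larger bound k + k^2 accommodates \<open>b'\<close>, which contains half the
    mean of a square.\<close>
  proof (rule insert.IH[where k = "k + k\<^sup>2"])
    show "\<bar>F x\<bar> \<le> k + k\<^sup>2" if "x \<in> space (PiM I M)" for x
      using F_bd[OF that] zero_le_power2[of k] by linarith
    show "c' j x \<le> k + k\<^sup>2" if "j \<in> I" "x \<in> space (PiM I M)" for j x
      using c_le[OF that] zero_le_power2[of k] by linarith
  qed (use F_meas b_meas c_meas b_bd c_nonneg F_le in auto)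
  also have "\<dots> \<le> (\<integral>x. \<integral>t. ?G (u x t) \<partial>M i \<partial>PiM I M)"
  proof (rule integral_mono)
    show "integrable (PiM I M) (\<lambda>x. b' x + (\<Sum>j\<in>I. (c' j x)\<^sup>2) / 2)"
    proof (intro Bochner_Integration.integrable_add integrable_divide_zero Bochner_Integration.integrable_sum)
      show "integrable (PiM I M) b'"
        using b_meas b_bd by (intro P.integrable_const_bound[where B = "k + k\<^sup>2"]) auto
      show "integrable (PiM I M) (\<lambda>x. (c' j x)\<^sup>2)" if "j \<in> I" for j
        using c_meas[OF that] c_nonneg[OF that] c_le[OF that]
        by (intro P.integrable_const_bound[where B = "k\<^sup>2"]) (auto intro: power_mono)
    qed
    show "integrable (PiM I M) (\<lambda>x. \<integral>t. ?G (u x t) \<partial>M i)"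
    proof (rule P.integrable_const_bound[where B = "k + card (insert i I) * k\<^sup>2"])
      show "(\<lambda>x. \<integral>t. ?G (u x t) \<partial>M i) \<in> borel_measurable (PiM I M)"
        by (rule meas[OF G_meas])
      show "AE x in PiM I M. norm (\<integral>t. ?G (u x t) \<partial>M i) \<le> k + card (insert i I) * k\<^sup>2"
        using meas1[OF _ G_meas] G_bd[OF sp]
        by (intro AE_I2) (simp only: real_norm_def, intro M.abs_integral_le_const, auto)
    qed
    fix x assume x: "x \<in> space (PiM I M)"
    \<comment> \<open>The square moves inside the mean over coordinate \<open>i\<close>, so that
      Fubini can reassemble the integral over all coordinates.\<close>
    have "(\<Sum>j\<in>I. (c' j x)\<^sup>2) \<le> (\<Sum>j\<in>I. \<integral>t. (c j (u x t))\<^sup>2 \<partial>M i)"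
      unfolding c'_def using insert.prems(6,7)[OF _ sp[OF x]] x
      by (intro sum_mono M.power2_integral_le[where k = k] meas1) auto
    then have "b' x + (\<Sum>j\<in>I. (c' j x)\<^sup>2) / 2
        \<le> b' x + (\<Sum>j\<in>I. \<integral>t. (c j (u x t))\<^sup>2 \<partial>M i) / 2" by simp
    also have "\<dots> = (\<integral>t. ?G (u x t) \<partial>M i)"
      unfolding b'_def using int_b[OF x] int_csq[OF _ x] insert.hyps
      by (simp add: add_divide_distrib)
    finally show "b' x + (\<Sum>j\<in>I. (c' j x)\<^sup>2) / 2 \<le> (\<integral>t. ?G (u x t) \<partial>M i)" .
  qed
  also have "\<dots> = (\<integral>x. ?G x \<partial>PiM (insert i I) M)"
    unfolding u_def using insert.hyps G_bd
    by (intro PS.product_integral_insert[symmetric]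
        Q.integrable_const_bound[where B = "k + card (insert i I) * k\<^sup>2"]) auto
  finally show ?case .
qed

section \<open>Resampling coordinates and infinite products\<close>

lemma measurable_override_on [measurable]:
  assumes "f \<in> L \<rightarrow>\<^sub>M PiM UNIV (\<lambda>_. N)" "g \<in> L \<rightarrow>\<^sub>M PiM UNIV (\<lambda>_. N)"
  shows "(\<lambda>w. override_on (f w) (g w) W) \<in> L \<rightarrow>\<^sub>M PiM UNIV (\<lambda>_. N)"
proof (rule measurable_PiM_single')
  show "(\<lambda>w. override_on (f w) (g w) W i) \<in> L \<rightarrow>\<^sub>M N" for i
    using measurable_compose[OF assms(1) measurable_component_singleton[of i]]
      measurable_compose[OF assms(2) measurable_component_singleton[of i]]
    by (cases "i \<in> W") (auto simp: override_on_def)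
  show "(\<lambda>w. override_on (f w) (g w) W) \<in> space L \<rightarrow> (\<Pi>\<^sub>E i\<in>UNIV. space N)"
    using measurable_space[OF assms(1)] measurable_space[OF assms(2)]
    by (auto simp: space_PiM PiE_iff override_on_def)
qed

text \<open>\<open>override_on z x W\<close> keeps \<open>x\<close> on \<open>W\<close> and resamples the remaining coordinates from \<open>z\<close>.\<close>

lemma distr_override_on:
  fixes N :: "'a measure" and W :: "'i set"
  assumes "prob_space N"
  shows "distr (PiM UNIV (\<lambda>_. N) \<Otimes>\<^sub>M PiM UNIV (\<lambda>_. N)) (PiM UNIV (\<lambda>_::'i. N))
           (\<lambda>(x, z). override_on z x W) = PiM UNIV (\<lambda>_. N)"
proof -
  interpret N: prob_space N by fact
  interpret product_prob_space "\<lambda>_::'i. N" UNIV by unfold_locales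
  let ?P = "PiM UNIV (\<lambda>_::'i. N)"
  have m: "(\<lambda>(x, z). override_on z x W) \<in> ?P \<Otimes>\<^sub>M ?P \<rightarrow>\<^sub>M ?P"
    using measurable_override_on[OF measurable_snd measurable_fst] by (simp add: case_prod_beta')
  show ?thesis
  proof (rule PiM_eq)
    fix J :: "'i set" and F
    assume J: "finite J" and F: "\<And>j. j \<in> J \<Longrightarrow> F j \<in> sets N"
    let ?E = "\<lambda>K. prod_emb UNIV (\<lambda>_::'i. N) K (\<Pi>\<^sub>E j\<in>K. F j)"
    have E: "?E K \<in> sets ?P" if "K \<subseteq> J" for K
      using that J F by (intro sets_PiM_I) (auto intro: finite_subset)
    \<comment> \<open>Coordinates in \<open>W\<close> are tested on x and the others on z, so the
      preimage of a cylinder is a rectangle.\<close>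
    have "(\<lambda>(x, z). override_on z x W) -` ?E J \<inter> space (?P \<Otimes>\<^sub>M ?P) = ?E (J \<inter> W) \<times> ?E (J - W)"
      by (auto simp: prod_emb_def space_pair_measure space_PiM override_on_def PiE_iff split: if_splits)
    then have "emeasure (distr (?P \<Otimes>\<^sub>M ?P) ?P (\<lambda>(x, z). override_on z x W)) (?E J)
        = emeasure ?P (?E (J \<inter> W)) * emeasure ?P (?E (J - W))"
      using E m by (simp add: emeasure_distr P.emeasure_pair_measure_Times)
    also have "\<dots> = (\<Prod>j\<in>J \<inter> W. emeasure N (F j)) * (\<Prod>j\<in>J - W. emeasure N (F j))"
      using J F by (intro arg_cong2[where f = "(*)"] emeasure_PiM_emb) auto
    also have "\<dots> = (\<Prod>j\<in>J. emeasure N (F j))"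
      using J by (subst prod.union_disjoint[symmetric]) (auto intro!: prod.cong)
    finally show "emeasure (distr (?P \<Otimes>\<^sub>M ?P) ?P (\<lambda>(x, z). override_on z x W)) (?E J)
        = (\<Prod>j\<in>J. emeasure N (F j))" .
  qed simp
qed

text \<open>The finite-product inequality with b = f. A function that reads only the coordinates in
  the finite set \<open>W\<close> has the same integral under \<open>P\<close> as under the marginal
  of \<open>P\<close> on \<open>W\<close>.\<close>

lemma ln_exp_integral_PiM_UNIV_le:
  fixes f :: "('i \<Rightarrow> 'a) \<Rightarrow> real" and c :: "'i \<Rightarrow> ('i \<Rightarrow> 'a) \<Rightarrow> real" and N :: "'a measure"
  defines "P \<equiv> PiM UNIV (\<lambda>_. N)"
  assumes "finite W" and N: "prob_space N"
    and f: "f \<in> borel_measurable P" and c: "\<And>i. i \<in> W \<Longrightarrow> c i \<in> borel_measurable P"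
    and f_bd: "\<And>x. x \<in> space P \<Longrightarrow> \<bar>f x\<bar> \<le> k"
    and c_nonneg: "\<And>i x. i \<in> W \<Longrightarrow> x \<in> space P \<Longrightarrow> 0 \<le> c i x"
    and c_bd: "\<And>i x. i \<in> W \<Longrightarrow> x \<in> space P \<Longrightarrow> c i x \<le> k"
    and f_dep: "\<And>x y. x \<in> space P \<Longrightarrow> y \<in> space P \<Longrightarrow> (\<And>i. i \<in> W \<Longrightarrow> x i = y i) \<Longrightarrow> f x = f y"
    and c_dep: "\<And>i x y. i \<in> W \<Longrightarrow> x \<in> space P \<Longrightarrow> y \<in> space P \<Longrightarrow> (\<And>i. i \<in> W \<Longrightarrow> x i = y i) \<Longrightarrow> c i x = c i y"
    and le: "\<And>x y. x \<in> space P \<Longrightarrow> y \<in> space P \<Longrightarrow>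
           f y \<le> f x + (\<Sum>i\<in>W. if x i = y i then 0 else c i x)"
  shows "ln (\<integral>x. exp (f x) \<partial>P) \<le> (\<integral>x. f x + (\<Sum>i\<in>W. (c i x)\<^sup>2) / 2 \<partial>P)"
proof -
  interpret N: prob_space N by fact
  interpret product_prob_space "\<lambda>_::'i. N" UNIV by unfold_locales
  have "prob_space P" unfolding P_def by (rule prob_space_PiM) (rule N)
  let ?W = "PiM W (\<lambda>_. N)"
  \<comment> \<open>A reference point fills the coordinates outside \<open>W\<close>; by
    \<open>f_dep\<close> and \<open>c_dep\<close> no value depends on its choice.\<close>
  obtain x0 where x0: "x0 \<in> space P" using prob_space.not_empty[OF \<open>prob_space P\<close>] by blast
  define ext where "ext x = override_on x0 x W" for x :: "'i \<Rightarrow> 'a"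
  have ext[measurable]: "ext \<in> ?W \<rightarrow>\<^sub>M P"
    unfolding P_def
  proof (rule measurable_PiM_single')
    show "(\<lambda>x. ext x i) \<in> ?W \<rightarrow>\<^sub>M N" for i
      using x0 by (cases "i \<in> W") (auto simp: ext_def override_on_def P_def space_PiM PiE_iff)
    show "ext \<in> space ?W \<rightarrow> (\<Pi>\<^sub>E i\<in>UNIV. space N)"
      using x0 by (auto simp: ext_def override_on_def P_def space_PiM PiE_iff)
  qed
  have sp: "ext x \<in> space P" if "x \<in> space ?W" for x
    using measurable_space[OF ext that] .
  have ext_W: "ext x i = x i" if "i \<in> W" for x i
    using that by (simp add: ext_def)
  have int: "(\<integral>x. h (ext x) \<partial>?W) = (\<integral>x. h x \<partial>P)"
    if h: "h \<in> borel_measurable P"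
      and dep: "\<And>x y. x \<in> space P \<Longrightarrow> y \<in> space P \<Longrightarrow> (\<And>i. i \<in> W \<Longrightarrow> x i = y i) \<Longrightarrow> h x = h y"
    for h :: "('i \<Rightarrow> 'a) \<Rightarrow> real"
  proof -
    have r: "(\<lambda>x. restrict x W) \<in> P \<rightarrow>\<^sub>M ?W"
      unfolding P_def by (rule measurable_restrict_subset) simp
    have "(\<integral>x. h (ext x) \<partial>?W) = (\<integral>x. h (ext x) \<partial>distr P ?W (\<lambda>x. restrict x W))"
      unfolding P_def using \<open>finite W\<close> by (subst distr_PiM_restrict_finite) auto
    also have "\<dots> = (\<integral>x. h (ext (restrict x W)) \<partial>P)"
      by (intro integral_distr r measurable_compose[OF ext h])
    also have "\<dots> = (\<integral>x. h x \<partial>P)"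
      using sp[OF measurable_space[OF r]] ext_W
      by (intro Bochner_Integration.integral_cong refl dep) auto
    finally show ?thesis .
  qed
  have "ln (\<integral>x. exp (f (ext x)) \<partial>?W) \<le> (\<integral>x. f (ext x) + (\<Sum>i\<in>W. (c i (ext x))\<^sup>2) / 2 \<partial>?W)"
  proof (rule ln_exp_integral_PiM_le[where k = k])
    show "f (ext y) \<le> f (ext x) + (\<Sum>i\<in>W. if x i = y i then 0 else c i (ext x))"
      if "x \<in> space ?W" "y \<in> space ?W" for x y
      using le[OF sp[OF that(1)] sp[OF that(2)]] by (simp add: ext_W cong: sum.cong)
  qed (use \<open>finite W\<close> N f c sp f_bd c_nonneg c_bd in \<open>auto intro: measurable_compose[OF ext]\<close>)
  moreover have "(\<integral>x. exp (f (ext x)) \<partial>?W) = (\<integral>x. exp (f x) \<partial>P)"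
    using f by (intro int) (auto intro!: f_dep)
  moreover have "(\<integral>x. f (ext x) + (\<Sum>i\<in>W. (c i (ext x))\<^sup>2) / 2 \<partial>?W)
      = (\<integral>x. f x + (\<Sum>i\<in>W. (c i x)\<^sup>2) / 2 \<partial>P)"
  proof (rule int)
    show "(\<lambda>x. f x + (\<Sum>i\<in>W. (c i x)\<^sup>2) / 2) \<in> borel_measurable P" using f c by measurable
    show "f x + (\<Sum>i\<in>W. (c i x)\<^sup>2) / 2 = f y + (\<Sum>i\<in>W. (c i y)\<^sup>2) / 2"
      if "x \<in> space P" "y \<in> space P" "\<And>i. i \<in> W \<Longrightarrow> x i = y i" for x y
      using f_dep[OF that] c_dep[OF _ that] by simp
  qed
  ultimately show ?thesis by simp
qed

section \<open>Balls in the lattice\<close>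

lemma sup_norm_le_iff: "sup_norm v \<le> r \<longleftrightarrow> (\<forall>k. \<bar>v $ k\<bar> \<le> int r)" for v :: "int ^ 'd::finite"
  unfolding sup_norm_def by (subst Max_le_iff) (auto simp: nat_le_iff)

lemma sup_norm_minus_commute: "sup_norm (a - b) = sup_norm (b - a)" for a b :: "int ^ 'd::finite"
  by (simp add: sup_norm_def abs_minus_commute)

lemma sup_norm_triangle: "sup_norm (a - c) \<le> sup_norm (a - b) + sup_norm (b - c)"
  for a b c :: "int ^ 'd::finite"
proof -
  have "\<bar>(a - c) $ k\<bar> \<le> int (sup_norm (a - b) + sup_norm (b - c))" for k
  proof -
    have "\<bar>(a - b) $ k\<bar> \<le> int (sup_norm (a - b))" "\<bar>(b - c) $ k\<bar> \<le> int (sup_norm (b - c))"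
      using sup_norm_le_iff[of "a - b"] sup_norm_le_iff[of "b - c"] by blast+
    then show ?thesis by simp
  qed
  then show ?thesis unfolding sup_norm_le_iff by blast
qed

lemma mem_sup_ball_enat [simp]: "i \<in> sup_ball j (enat r) \<longleftrightarrow> sup_norm (i - j) \<le> r"
  by (simp add: sup_ball_def)

text \<open>Being a box of integer intervals, a ball has its finiteness and cardinality computed
  coordinatewise.\<close>

lemma sup_ball_eq_image:
  "sup_ball (j :: int ^ 'd::finite) (enat r)
     = vec_lambda ` (\<Pi>\<^sub>E k\<in>UNIV. {j $ k - int r..j $ k + int r})" (is "_ = vec_lambda ` ?B")
proof -
  have iff: "i \<in> sup_ball j (enat r) \<longleftrightarrow> vec_nth i \<in> ?B" for i
    by (simp add: sup_norm_le_iff abs_le_iff PiE_iff) (intro iff_allI, arith)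
  show ?thesis
  proof (intro set_eqI iffI)
    fix i assume "i \<in> sup_ball j (enat r)"
    then show "i \<in> vec_lambda ` ?B" unfolding iff by (rule image_eqI[rotated]) simp
  next
    fix i assume "i \<in> vec_lambda ` ?B"
    then obtain g where "g \<in> ?B" "i = vec_lambda g" by blast
    then show "i \<in> sup_ball j (enat r)" unfolding iff by (simp add: vec_lambda_inverse)
  qed
qed

lemma finite_sup_ball [simp]: "finite (sup_ball (j :: int ^ 'd::finite) (enat r))"
  unfolding sup_ball_eq_image by (intro finite_imageI finite_PiE) auto

lemma card_sup_ball: "card (sup_ball (j :: int ^ 'd::finite) (enat r)) = (2 * r + 1) ^ CARD('d)"
proof -
  have "nat (int r + (j $ k + int r) + 1 - j $ k) = 2 * r + 1" for k by simp
  then show ?thesis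
    unfolding sup_ball_eq_image
    by (subst card_image) (auto simp: inj_on_def vec_lambda_inject card_PiE algebra_simps)
qed

text \<open>If the balls meet, their centres are at most r + s apart, hence at most twice the larger
  radius, and the larger ball bounds the intersection. Each summand involves one radius only, so
  stationarity can later move its expectation to the origin.\<close>

lemma card_sup_ball_Int_le:
  fixes j k :: "int ^ 'd::finite"
  shows "card (sup_ball j (enat r) \<inter> sup_ball k (enat s))
    \<le> (2 * r + 1) ^ CARD('d) * of_bool (sup_norm (k - j) \<le> 2 * r)
      + (2 * s + 1) ^ CARD('d) * of_bool (sup_norm (j - k) \<le> 2 * s)"
proof (cases "sup_ball j (enat r) \<inter> sup_ball k (enat s) = {}")
  case False
  then obtain i where i: "sup_norm (i - j) \<le> r" "sup_norm (i - k) \<le> s" by auto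
  then have d: "sup_norm (k - j) \<le> s + r" "sup_norm (j - k) \<le> r + s"
    using sup_norm_triangle[of k j i] sup_norm_triangle[of j k i] by (auto simp: sup_norm_minus_commute)
  show ?thesis
  proof (cases "s \<le> r")
    case True
    have "card (sup_ball j (enat r) \<inter> sup_ball k (enat s)) \<le> card (sup_ball j (enat r))"
      by (intro card_mono) auto
    then show ?thesis using d True by (simp add: card_sup_ball)
  next
    case False
    have "card (sup_ball j (enat r) \<inter> sup_ball k (enat s)) \<le> card (sup_ball k (enat s))"
      by (intro card_mono) auto
    then show ?thesis using d False by (simp add: card_sup_ball)
  qed
qed simp

section \<open>The total squared influence\<close>

text \<open>Expanding the square leaves, for each pair j, k, the number of points of
  \<open>W\<close> that lie in both balls. After \<open>\<delta> j * \<delta> k\<close> is bounded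
  by the mean of the two squares, exchanging j and k in one half merges the halves, because
  \<open>T j k + T k j\<close> is symmetric.\<close>

lemma sum_power2_influence_le:
  fixes D W :: "(int ^ 'd::finite) set" and \<delta> :: "int ^ 'd \<Rightarrow> real" and r :: "int ^ 'd \<Rightarrow> nat"
  assumes D: "finite D" and W: "finite W" and \<delta>: "\<And>j. 0 \<le> \<delta> j"
  defines "T \<equiv> \<lambda>j k. (2 * real (r j) + 1) ^ CARD('d) * of_bool (sup_norm (k - j) \<le> 2 * r j)"
  shows "(\<Sum>i\<in>W. (\<Sum>j\<in>D. \<delta> j * of_bool (i \<in> sup_ball j (enat (r j))))\<^sup>2)
     \<le> (\<Sum>j\<in>D. \<Sum>k\<in>D. (\<delta> j)\<^sup>2 * (T j k + T k j))"
proof -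
  let ?b = "\<lambda>i j. of_bool (i \<in> sup_ball j (enat (r j))) :: real"
  have card_le: "(\<Sum>i\<in>W. ?b i j * ?b i k) \<le> T j k + T k j" for j k
  proof -
    have "(\<Sum>i\<in>W. ?b i j * ?b i k) = real (card (W \<inter> (sup_ball j (enat (r j)) \<inter> sup_ball k (enat (r k)))))"
    proof -
      define A where "A = sup_ball j (enat (r j)) \<inter> sup_ball k (enat (r k))"
      have "?b i j * ?b i k = of_bool (i \<in> A)" for i
        unfolding A_def of_bool_def by (simp only: Int_iff) simp
      then have "(\<Sum>i\<in>W. ?b i j * ?b i k) = (\<Sum>i\<in>W. of_bool (i \<in> A))" by (simp only:)
      also have "\<dots> = real (card (W \<inter> {i. i \<in> A}))" by (intro sum_of_bool_eq W)
      finally show ?thesis unfolding A_def Collect_mem_eq .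
    qed
    also have "\<dots> \<le> real (card (sup_ball j (enat (r j)) \<inter> sup_ball k (enat (r k))))"
      by (intro of_nat_mono card_mono) auto
    also have "\<dots> \<le> real ((2 * r j + 1) ^ CARD('d) * of_bool (sup_norm (k - j) \<le> 2 * r j)
      + (2 * r k + 1) ^ CARD('d) * of_bool (sup_norm (j - k) \<le> 2 * r k))"
      by (intro of_nat_mono card_sup_ball_Int_le)
    also have "\<dots> = T j k + T k j" by (simp add: T_def add.commute)
    finally show ?thesis .
  qed
  have T0: "0 \<le> T j k" for j k by (simp add: T_def)
  have "(\<Sum>i\<in>W. (\<Sum>j\<in>D. \<delta> j * ?b i j)\<^sup>2) = (\<Sum>i\<in>W. \<Sum>j\<in>D. \<Sum>k\<in>D. \<delta> j * \<delta> k * (?b i j * ?b i k))"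
    unfolding power2_eq_square sum_product
    by (intro sum.cong refl) (simp only: mult.assoc mult.left_commute)
  also have "\<dots> = (\<Sum>j\<in>D. \<Sum>i\<in>W. \<Sum>k\<in>D. \<delta> j * \<delta> k * (?b i j * ?b i k))"
    by (rule sum.swap)
  also have "\<dots> = (\<Sum>j\<in>D. \<Sum>k\<in>D. \<delta> j * \<delta> k * (\<Sum>i\<in>W. ?b i j * ?b i k))"
    unfolding sum_distrib_left by (rule sum.cong[OF refl], rule sum.swap)
  also have "\<dots> \<le> (\<Sum>j\<in>D. \<Sum>k\<in>D. ((\<delta> j)\<^sup>2 / 2 + (\<delta> k)\<^sup>2 / 2) * (T j k + T k j))"
  proof (intro sum_mono mult_mono card_le)
    show "\<delta> j * \<delta> k \<le> (\<delta> j)\<^sup>2 / 2 + (\<delta> k)\<^sup>2 / 2" for j k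
      using sum_squares_bound[of "\<delta> j" "\<delta> k"] by simp
    show "0 \<le> (\<Sum>i\<in>W. ?b i j * ?b i k)" for j k by (intro sum_nonneg) simp
  qed simp
  also have "\<dots> = (\<Sum>j\<in>D. \<Sum>k\<in>D. (\<delta> j)\<^sup>2 / 2 * (T j k + T k j))
      + (\<Sum>j\<in>D. \<Sum>k\<in>D. (\<delta> k)\<^sup>2 / 2 * (T j k + T k j))"
    by (simp only: distrib_right sum.distrib)
  also have "(\<Sum>j\<in>D. \<Sum>k\<in>D. (\<delta> k)\<^sup>2 / 2 * (T j k + T k j)) = (\<Sum>j\<in>D. \<Sum>k\<in>D. (\<delta> j)\<^sup>2 / 2 * (T j k + T k j))"
    by (subst sum.swap) (simp only: add.commute)
  finally show ?thesis by (simp add: sum.distrib[symmetric])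
qed

text \<open>In the previous bound every term involves the radius at a single site, so by
  stationarity it can be evaluated at the origin. The leading factor 2 comes from the two terms per
  pair, and summing over k counts the sites in a ball of radius 2 r.\<close>

lemma (in prob_space) integral_sum_power2_influence_le:
  fixes D W :: "(int ^ 'd::finite) set" and \<delta> :: "int ^ 'd \<Rightarrow> real"
    and r :: "int ^ 'd \<Rightarrow> 'a \<Rightarrow> nat"
  assumes D: "finite D" and W: "finite W" and \<delta>: "\<And>j. 0 \<le> \<delta> j"
    and r_meas: "\<And>j. r j \<in> M \<rightarrow>\<^sub>M count_space UNIV"
    and r_le: "\<And>j x. r j x \<le> n"
    and stationary: "\<And>j (h :: nat \<Rightarrow> real). (\<integral>x. h (r j x) \<partial>M) = (\<integral>x. h (r 0 x) \<partial>M)"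
  shows "(\<integral>x. (\<Sum>i\<in>W. (\<Sum>j\<in>D. \<delta> j * of_bool (i \<in> sup_ball j (enat (r j x))))\<^sup>2) \<partial>M)
     \<le> 2 * 2 ^ CARD('d) * (\<integral>x. (2 * real (r 0 x) + 1) ^ (2 * CARD('d)) \<partial>M) * (\<Sum>j\<in>D. (\<delta> j)\<^sup>2)"
proof -
  have meas: "(\<lambda>x. h (r j x)) \<in> borel_measurable M" for h :: "nat \<Rightarrow> real" and j
    by (rule measurable_compose[OF r_meas]) simp
  have int: "integrable M (\<lambda>x. h (r j x))" for h :: "nat \<Rightarrow> real" and j
  \<comment> \<open>A function of a radius that is at most \<open>n\<close> takes finitely many
    values.\<close>
  proof (rule integrable_const_bound[where B = "Max ((\<lambda>m. \<bar>h m\<bar>) ` {..n})"])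
    show "AE x in M. norm (h (r j x)) \<le> Max ((\<lambda>m. \<bar>h m\<bar>) ` {..n})"
      using r_le by (intro AE_I2) (auto intro!: Max_ge)
  qed (rule meas)
  define t where "t v m = (2 * real m + 1) ^ CARD('d) * of_bool (sup_norm v \<le> 2 * m)"
    for v :: "int ^ 'd" and m
  \<comment> \<open>The norm is symmetric and the radius at k has the law of the radius at the
    origin, so both terms of a pair have the same mean.\<close>
  have swap: "(\<integral>x. t (j - k) (r k x) \<partial>M) = (\<integral>x. t (k - j) (r 0 x) \<partial>M)" for j k
    by (subst stationary) (simp add: t_def sup_norm_minus_commute)
  have row: "(\<Sum>k\<in>D. \<integral>x. t (k - j) (r 0 x) \<partial>M) \<le> 2 ^ CARD('d) * (\<integral>x. (2 * real (r 0 x) + 1) ^ (2 * CARD('d)) \<partial>M)"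
    for j
  proof -
    have "(\<Sum>k\<in>D. t (k - j) m) \<le> 2 ^ CARD('d) * (2 * real m + 1) ^ (2 * CARD('d))" for m
    proof -
      have "(\<Sum>k\<in>D. t (k - j) m) = (2 * real m + 1) ^ CARD('d) * real (card (D \<inter> sup_ball j (enat (2 * m))))"
        using D by (simp add: t_def sum_distrib_left[symmetric] Int_def)
      also have "\<dots> \<le> (2 * real m + 1) ^ CARD('d) * real (card (sup_ball j (enat (2 * m))))"
        by (intro mult_left_mono of_nat_mono card_mono) auto
      \<comment> \<open>The factor 2^d arises from 4 m + 1 <= 2 (2 m + 1).\<close>
      also have "\<dots> \<le> (2 * real m + 1) ^ CARD('d) * (2 * (2 * real m + 1)) ^ CARD('d)"
        by (intro mult_left_mono) (auto simp: card_sup_ball intro!: power_mono)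
      also have "\<dots> = 2 ^ CARD('d) * (2 * real m + 1) ^ (2 * CARD('d))"
        unfolding power_mult_distrib mult_2[of "CARD('d)"] power_add by (simp only: mult_ac)
      finally show ?thesis .
    qed
    then have "(\<integral>x. (\<Sum>k\<in>D. t (k - j) (r 0 x)) \<partial>M)
        \<le> (\<integral>x. 2 ^ CARD('d) * (2 * real (r 0 x) + 1) ^ (2 * CARD('d)) \<partial>M)"
      using int[of "\<lambda>m. (\<Sum>k\<in>D. t (k - j) m)" 0]
        int[of "\<lambda>m. 2 ^ CARD('d) * (2 * real m + 1) ^ (2 * CARD('d))" 0]
      by (intro integral_mono) auto
    then show ?thesis using int[of "t _" 0] by simp
  qed
  have "(\<integral>x. (\<Sum>i\<in>W. (\<Sum>j\<in>D. \<delta> j * of_bool (i \<in> sup_ball j (enat (r j x))))\<^sup>2) \<partial>M)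
      \<le> (\<integral>x. (\<Sum>j\<in>D. \<Sum>k\<in>D. (\<delta> j)\<^sup>2 * (t (k - j) (r j x) + t (j - k) (r k x))) \<partial>M)"
  proof (rule integral_mono)
    have bnd: "\<bar>\<Sum>j\<in>D. \<delta> j * of_bool (i \<in> sup_ball j (enat (r j x)))\<bar> \<le> (\<Sum>j\<in>D. \<delta> j)" for i x
      using \<delta> by (auto intro!: order_trans[OF sum_abs] sum_mono)
    have "((\<Sum>j\<in>D. \<delta> j * of_bool (i \<in> sup_ball j (enat (r j x))))\<^sup>2) \<le> (\<Sum>j\<in>D. \<delta> j)\<^sup>2" for i x
      using power_mono[OF bnd[of i x], of 2] by simp
    then show "integrable M (\<lambda>x. \<Sum>i\<in>W. (\<Sum>j\<in>D. \<delta> j * of_bool (i \<in> sup_ball j (enat (r j x))))\<^sup>2)"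
      by (intro Bochner_Integration.integrable_sum integrable_const_bound[where B = "(\<Sum>j\<in>D. \<delta> j)\<^sup>2"]
          borel_measurable_power borel_measurable_sum borel_measurable_times
          borel_measurable_const meas[of "\<lambda>m. of_bool (_ \<in> sup_ball _ (enat m))"] AE_I2) auto
    show "integrable M (\<lambda>x. \<Sum>j\<in>D. \<Sum>k\<in>D. (\<delta> j)\<^sup>2 * (t (k - j) (r j x) + t (j - k) (r k x)))"
      using int by (intro Bochner_Integration.integrable_sum integrable_mult_right
          Bochner_Integration.integrable_add) auto
    fix x
    show "(\<Sum>i\<in>W. (\<Sum>j\<in>D. \<delta> j * of_bool (i \<in> sup_ball j (enat (r j x))))\<^sup>2)
      \<le> (\<Sum>j\<in>D. \<Sum>k\<in>D. (\<delta> j)\<^sup>2 * (t (k - j) (r j x) + t (j - k) (r k x)))"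
      unfolding t_def by (rule sum_power2_influence_le[OF D W \<delta>])
  qed
  also have "\<dots> = (\<Sum>j\<in>D. \<Sum>k\<in>D. (\<delta> j)\<^sup>2 * ((\<integral>x. t (k - j) (r j x) \<partial>M) + (\<integral>x. t (j - k) (r k x) \<partial>M)))"
    using int by (simp del: sum_distrib_left)
  also have "\<dots> = (\<Sum>j\<in>D. (\<delta> j)\<^sup>2 * (2 * (\<Sum>k\<in>D. \<integral>x. t (k - j) (r 0 x) \<partial>M)))"
  proof -
    have "(\<integral>x. t (k - j) (r j x) \<partial>M) + (\<integral>x. t (j - k) (r k x) \<partial>M) = 2 * (\<integral>x. t (k - j) (r 0 x) \<partial>M)" for j k
      using swap[of j k] stationary[of "t (k - j)" j] by linarith
    then show ?thesis by (simp add: sum_distrib_left)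
  qed
  also have "\<dots> \<le> (\<Sum>j\<in>D. (\<delta> j)\<^sup>2 * (2 * (2 ^ CARD('d) * (\<integral>x. (2 * real (r 0 x) + 1) ^ (2 * CARD('d)) \<partial>M))))"
    using row by (intro sum_mono mult_left_mono) auto
  also have "\<dots> = 2 * 2 ^ CARD('d) * (\<integral>x. (2 * real (r 0 x) + 1) ^ (2 * CARD('d)) \<partial>M) * (\<Sum>j\<in>D. (\<delta> j)\<^sup>2)"
    unfolding sum_distrib_right[symmetric] by (simp only: mult_ac)
  finally show ?thesis .
qed

section \<open>A measurable coding radius\<close>

text \<open>\<open>\<psi>\<close> stands for the coordinate at the origin of a coding and
  \<open>window r\<close> for the ball of radius r. The countable family \<open>\<U>\<close> reduces
  equality of two values in \<open>MB\<close> to countably many measurable events.\<close>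

locale resampling = N: prob_space N
  for N :: "'a measure" +
  fixes MB :: "'b measure" and \<psi> :: "('i \<Rightarrow> 'a) \<Rightarrow> 'b"
    and \<U> :: "'b set set" and window :: "nat \<Rightarrow> 'i set"
  assumes \<psi>: "\<psi> \<in> PiM UNIV (\<lambda>_. N) \<rightarrow>\<^sub>M MB"
    and countable_\<U>: "countable \<U>"
    and sets_\<U>: "\<U> \<subseteq> sets MB"
    and separating: "\<And>a b. a \<in> space MB \<Longrightarrow> b \<in> space MB \<Longrightarrow> (\<And>U. U \<in> \<U> \<Longrightarrow> a \<in> U \<longleftrightarrow> b \<in> U) \<Longrightarrow> a = b"
    and mono_window: "mono window"
begin

abbreviation P :: "('i \<Rightarrow> 'a) measure" where "P \<equiv> PiM UNIV (\<lambda>_. N)"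

abbreviation resample :: "nat \<Rightarrow> ('i \<Rightarrow> 'a) \<Rightarrow> ('i \<Rightarrow> 'a) \<Rightarrow> 'i \<Rightarrow> 'a" where
  "resample r x z \<equiv> override_on z x (window r)"

text \<open>The almost sure counterpart of the condition in the coding radius. Quantifying over
  almost every configuration outside the window, rather than over every one, keeps the condition
  measurable.\<close>

definition determined :: "nat \<Rightarrow> ('i \<Rightarrow> 'a) \<Rightarrow> bool" where
  "determined r x \<longleftrightarrow> (\<exists>b \<in> space MB. AE z in P. \<psi> (resample r x z) = b)"

text \<open>Under \<open>determined\<close> the chosen constant is unique, since \<open>P\<close> is
  a probability measure.\<close>

definition forced :: "nat \<Rightarrow> ('i \<Rightarrow> 'a) \<Rightarrow> 'b" where
  "forced r x = (SOME b. b \<in> space MB \<and> (AE z in P. \<psi> (resample r x z) = b))"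

text \<open>The alternative \<open>r = n\<close> makes the least element exist and caps the radius
  at \<open>n\<close>, as for a bounded stopping time.\<close>

definition radius :: "nat \<Rightarrow> ('i \<Rightarrow> 'a) \<Rightarrow> nat" where
  "radius n x = (LEAST r. r = n \<or> determined r x)"

text \<open>The default \<open>b\<^sub>0\<close> is taken exactly when no r <= n determines the
  value.\<close>

definition truncated :: "nat \<Rightarrow> 'b \<Rightarrow> ('i \<Rightarrow> 'a) \<Rightarrow> 'b" where
  "truncated n b\<^sub>0 x = (if determined (radius n x) x then forced (radius n x) x else b\<^sub>0)"

sublocale P: prob_space P
  by (intro prob_space_PiM N.prob_space_axioms)

sublocale PP: pair_prob_space P P ..

lemma measurable_resample [measurable]: "(\<lambda>(x, z). resample r x z) \<in> P \<Otimes>\<^sub>M P \<rightarrow>\<^sub>M P"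
  using measurable_override_on[OF measurable_snd measurable_fst] by (simp add: case_prod_beta')

lemma measurable_psi_resample: "(\<lambda>(x, z). \<psi> (resample r x z)) \<in> P \<Otimes>\<^sub>M P \<rightarrow>\<^sub>M MB"
  using measurable_compose[OF measurable_resample \<psi>] by (simp add: case_prod_beta')

lemma psi_resample_in_space: "x \<in> space P \<Longrightarrow> z \<in> space P \<Longrightarrow> \<psi> (resample r x z) \<in> space MB"
  using measurable_space[OF measurable_psi_resample, of "(x, z)"] by (simp add: space_pair_measure)

text \<open>The condition says that the section at x of a measurable subset of the product is a null
  set, and the measure of a section is a measurable function of x.\<close>

lemma measurable_AE_resample:
  assumes U: "U \<in> sets MB"
  shows "Measurable.pred P (\<lambda>x. AE z in P. \<psi> (resample r x z) \<in> U)"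
proof -
  let ?Q = "{p \<in> space (P \<Otimes>\<^sub>M P). \<psi> (resample r (fst p) (snd p)) \<notin> U}"
  have Q: "?Q \<in> sets (P \<Otimes>\<^sub>M P)"
  proof -
    have "?Q = space (P \<Otimes>\<^sub>M P) - ((\<lambda>(x, z). \<psi> (resample r x z)) -` U \<inter> space (P \<Otimes>\<^sub>M P))" by auto
    then show ?thesis using measurable_sets[OF measurable_psi_resample U] by simp
  qed
  have "(AE z in P. \<psi> (resample r x z) \<in> U) \<longleftrightarrow> emeasure P (Pair x -` ?Q) = 0" if x: "x \<in> space P" for x
    using x by (intro AE_iff_measurable sets_Pair1[OF Q]) (auto simp: space_pair_measure)
  moreover have "Measurable.pred P (\<lambda>x. emeasure P (Pair x -` ?Q) = 0)"
    using P.measurable_emeasure_Pair[OF Q] by measurable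
  ultimately show ?thesis by (simp cong: measurable_cong)
qed

lemma resample_cong:
  assumes "\<And>i. i \<in> window r \<Longrightarrow> x i = y i"
  shows "resample r x z = resample r y z"
  using assms by (auto simp: override_on_def)

lemma determined_cong:
  assumes "\<And>i. i \<in> window r \<Longrightarrow> x i = y i"
  shows "determined r x \<longleftrightarrow> determined r y" and "forced r x = forced r y"
proof -
  have "resample r x z = resample r y z" for z by (rule resample_cong) (rule assms)
  then show "determined r x \<longleftrightarrow> determined r y" "forced r x = forced r y"
    by (simp_all only: determined_def forced_def)
qed

lemma forced:
  assumes "determined r x"
  shows "forced r x \<in> space MB" and "AE z in P. \<psi> (resample r x z) = forced r x"
  using someI_ex[OF assms[unfolded determined_def Bex_def]] unfolding forced_def by auto

text \<open>Expresses membership of the chosen value through the events of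
  \<open>measurable_AE_resample\<close>, which makes \<open>forced\<close> accessible to
  measurability arguments.\<close>

lemma forced_mem_iff:
  assumes "determined r x"
  shows "forced r x \<in> U \<longleftrightarrow> (AE z in P. \<psi> (resample r x z) \<in> U)"
proof
  assume "forced r x \<in> U"
  then show "AE z in P. \<psi> (resample r x z) \<in> U" using forced(2)[OF assms] by (auto elim: AE_mp)
next
  assume "AE z in P. \<psi> (resample r x z) \<in> U"
  then have "AE z in P. forced r x \<in> U" using forced(2)[OF assms] by eventually_elim simp
  then show "forced r x \<in> U" by simp
qed

text \<open>A random value is almost surely constant as soon as every event of a countable
  separating family has probability zero or one. This turns the existential over \<open>MB\<close>
  into a countable intersection.\<close>

lemma determined_iff:
  assumes x: "x \<in> space P"
  shows "determined r x \<longleftrightarrow>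
    (\<forall>U \<in> \<U>. (AE z in P. \<psi> (resample r x z) \<in> U) \<or> (AE z in P. \<psi> (resample r x z) \<in> space MB - U))"
proof
  assume det: "determined r x"
  show "\<forall>U \<in> \<U>. (AE z in P. \<psi> (resample r x z) \<in> U) \<or> (AE z in P. \<psi> (resample r x z) \<in> space MB - U)"
    unfolding forced_mem_iff[OF det, symmetric] using forced(1)[OF det] by blast
next
  assume *: "\<forall>U \<in> \<U>. (AE z in P. \<psi> (resample r x z) \<in> U) \<or> (AE z in P. \<psi> (resample r x z) \<in> space MB - U)"
  have "AE z in P. \<psi> (resample r x z) \<in> U \<longleftrightarrow> (AE z in P. \<psi> (resample r x z) \<in> U)" if U: "U \<in> \<U>" for U
  proof (cases "AE z in P. \<psi> (resample r x z) \<in> U")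
    case True then show ?thesis by simp
  next
    case False
    then have "AE z in P. \<psi> (resample r x z) \<in> space MB - U" using * U by blast
    then show ?thesis using False by (auto elim: AE_mp)
  qed
  then have ae: "AE z in P. z \<in> space P \<and>
      (\<forall>U \<in> \<U>. \<psi> (resample r x z) \<in> U \<longleftrightarrow> (AE z in P. \<psi> (resample r x z) \<in> U))"
    using countable_\<U> by (simp add: AE_ball_countable)
  \<comment> \<open>Any point outside the common null set serves: the value there is the
    constant.\<close>
  obtain z\<^sub>0 where z\<^sub>0: "z\<^sub>0 \<in> space P"
      "\<forall>U \<in> \<U>. \<psi> (resample r x z\<^sub>0) \<in> U \<longleftrightarrow> (AE z in P. \<psi> (resample r x z) \<in> U)"
    using eventually_happens'[OF P.ae_filter_bot ae] by blast
  from ae have "AE z in P. \<psi> (resample r x z) = \<psi> (resample r x z\<^sub>0)"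
  proof eventually_elim
    case (elim z)
    then show ?case
      using z\<^sub>0 x by (intro separating psi_resample_in_space) auto
  qed
  then show "determined r x"
    unfolding determined_def using psi_resample_in_space[OF x z\<^sub>0(1)] by blast
qed

lemma measurable_determined [measurable]: "Measurable.pred P (determined r)"
proof -
  have "Measurable.pred P (\<lambda>x. \<forall>U \<in> \<U>. (AE z in P. \<psi> (resample r x z) \<in> U)
      \<or> (AE z in P. \<psi> (resample r x z) \<in> space MB - U))"
    unfolding pred_def
  proof (rule sets.sets_Collect_countable_All'[OF _ countable_\<U>])
    fix U assume "U \<in> \<U>"
    then have "Measurable.pred P (\<lambda>x. (AE z in P. \<psi> (resample r x z) \<in> U)
        \<or> (AE z in P. \<psi> (resample r x z) \<in> space MB - U))"
      using sets_\<U> by (intro pred_intros_logic measurable_AE_resample) auto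
    then show "{x \<in> space P. (AE z in P. \<psi> (resample r x z) \<in> U)
        \<or> (AE z in P. \<psi> (resample r x z) \<in> space MB - U)} \<in> sets P"
      unfolding pred_def .
  qed
  then show ?thesis using determined_iff by (simp cong: measurable_cong)
qed

lemma radius_le: "radius n x \<le> n"
  unfolding radius_def by (rule Least_le) simp

lemma radius_le_determined: "determined r x \<Longrightarrow> radius n x \<le> r"
  unfolding radius_def by (rule Least_le) simp

lemma determined_radius:
  assumes "determined r x" "r \<le> n"
  shows "determined (radius n x) x"
proof -
  have "radius n x = n \<or> determined (radius n x) x"
    unfolding radius_def by (rule LeastI[of _ n]) simp
  then show ?thesis using radius_le_determined[OF assms(1), of n] assms by auto
qed

lemma measurable_radius [measurable]: "radius n \<in> P \<rightarrow>\<^sub>M count_space UNIV"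
  unfolding radius_def[abs_def] by measurable

lemma measurable_truncated:
  assumes b\<^sub>0: "b\<^sub>0 \<in> space MB"
  shows "truncated n b\<^sub>0 \<in> P \<rightarrow>\<^sub>M MB"
proof -
  \<comment> \<open>The radius takes countably many values, so it suffices to treat each fixed
    r.\<close>
  have "(\<lambda>x. if determined r x then forced r x else b\<^sub>0) \<in> P \<rightarrow>\<^sub>M MB" for r
  proof (rule measurableI)
    show "(if determined r x then forced r x else b\<^sub>0) \<in> space MB" for x
      using forced(1) b\<^sub>0 by simp
    fix U assume U: "U \<in> sets MB"
    have "(\<lambda>x. if determined r x then forced r x else b\<^sub>0) -` U \<inter> space P
      = {x \<in> space P. (determined r x \<and> (AE z in P. \<psi> (resample r x z) \<in> U)) \<or> (\<not> determined r x \<and> b\<^sub>0 \<in> U)}"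
      by (auto simp: forced_mem_iff split: if_splits)
    then show "(\<lambda>x. if determined r x then forced r x else b\<^sub>0) -` U \<inter> space P \<in> sets P"
      using measurable_AE_resample[OF U, of r] by simp
  qed
  then show ?thesis
    unfolding truncated_def[abs_def]
    by (rule measurable_compose_countable[where f = "\<lambda>r x. if determined r x then forced r x else b\<^sub>0"])
      measurable
qed

lemma truncated_in_space: "b\<^sub>0 \<in> space MB \<Longrightarrow> truncated n b\<^sub>0 x \<in> space MB"
  using forced(1) by (simp add: truncated_def)

text \<open>The stopping property: since the windows increase, every test up to the radius of x
  reads only coordinates in the final window, where x and y agree.\<close>

lemma
  assumes "\<And>i. i \<in> window (radius n x) \<Longrightarrow> x i = y i"
  shows radius_cong: "radius n x = radius n y"
    and truncated_cong: "truncated n b\<^sub>0 x = truncated n b\<^sub>0 y"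
proof -
  have eq: "determined r x \<longleftrightarrow> determined r y" if "r \<le> radius n x" for r
    using assms monoD[OF mono_window that] by (intro determined_cong) blast
  have "radius n x = n \<or> determined (radius n x) x"
    unfolding radius_def by (rule LeastI[of _ n]) simp
  then have le: "radius n y \<le> radius n x"
    unfolding radius_def[of n y] using eq[OF order_refl] by (intro Least_le) simp
  have "radius n y = n \<or> determined (radius n y) y"
    unfolding radius_def by (rule LeastI[of _ n]) simp
  \<comment> \<open>By \<open>le\<close> the radius of y is also within the range of
    \<open>eq\<close>, so the test it passes transfers back to x.\<close>
  then show r: "radius n x = radius n y"
    using le eq[OF le] radius_le[of n x] radius_le_determined by (auto intro: antisym)
  show "truncated n b\<^sub>0 x = truncated n b\<^sub>0 y"
    using determined_cong[OF assms] by (simp add: truncated_def flip: r)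
qed

text \<open>By definition the forced value is that of \<open>\<psi>\<close> at
  \<open>resample r x z\<close> for almost every z. For independent x and z this point has law
  \<open>P\<close> again, and resampling leaves the window, hence \<open>determined\<close> and
  \<open>forced\<close>, unchanged; so the statement passes to almost every x. It is proved for one
  \<open>U\<close> at a time to work with measurable predicates.\<close>

lemma AE_eq_forced: "AE x in P. determined r x \<longrightarrow> \<psi> x = forced r x"
proof -
  have "AE x in P. determined r x \<longrightarrow> (\<psi> x \<in> U \<longleftrightarrow> (AE z in P. \<psi> (resample r x z) \<in> U))" (is "AE x in P. ?Q x")
    if U: "U \<in> \<U>" for U
  proof -
    have [measurable]: "Measurable.pred P (\<lambda>x. \<psi> x \<in> U)" "Measurable.pred P (\<lambda>x. AE z in P. \<psi> (resample r x z) \<in> U)"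
      using U sets_\<U> \<psi> measurable_AE_resample by auto
    have Q[measurable]: "Measurable.pred P ?Q" by measurable
    \<comment> \<open>Resampling twice outside the same window amounts to resampling once.\<close>
    have res: "(AE z' in P. \<psi> (resample r (resample r x z) z') \<in> U) \<longleftrightarrow> (AE z' in P. \<psi> (resample r x z') \<in> U)" for x z
      by (subst resample_cong[of r "resample r x z" x]) simp_all
    have "AE x in P. AE z in P. ?Q (resample r x z)"
    proof (rule AE_I2)
      fix x
      show "AE z in P. ?Q (resample r x z)"
      proof (cases "determined r x")
        case True
        show ?thesis
          using forced(2)[OF True] by eventually_elim (simp add: res forced_mem_iff[OF True])
      next
        case False
        then show ?thesis by (simp add: determined_cong(1)[of r "resample r _ _" x])
      qed
    qed
    then have "AE p in P \<Otimes>\<^sub>M P. ?Q (resample r (fst p) (snd p))"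
      using measurable_resample[of r] by (intro PP.AE_pair_measure) (simp_all add: case_prod_beta')
    then have "AE x in distr (P \<Otimes>\<^sub>M P) P (\<lambda>(x, z). resample r x z). ?Q x"
      by (subst AE_distr_iff) (simp_all add: case_prod_beta')
    then show ?thesis unfolding distr_override_on[OF N.prob_space_axioms] .
  qed
  then have "AE x in P. \<forall>U \<in> \<U>. determined r x \<longrightarrow> (\<psi> x \<in> U \<longleftrightarrow> (AE z in P. \<psi> (resample r x z) \<in> U))"
    by (subst AE_ball_countable[OF countable_\<U>]) blast
  then show ?thesis
    using AE_space
  proof eventually_elim
    case (elim x)
    then show ?case
      using measurable_space[OF \<psi>] forced(1) by (auto intro!: separating simp: forced_mem_iff)
  qed
qed

lemma AE_truncated_eq: "AE x in P. (\<exists>r\<le>n. determined r x) \<longrightarrow> truncated n b\<^sub>0 x = \<psi> x"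
proof -
  have "AE x in P. \<forall>r. determined r x \<longrightarrow> \<psi> x = forced r x"
    by (simp add: AE_all_countable AE_eq_forced)
  then show ?thesis
    by eventually_elim (auto simp: truncated_def dest: determined_radius)
qed

text \<open>A condition on all configurations agreeing on the window implies its almost sure
  version. This is why the measurable radius is at most the coding radius.\<close>

lemma determinedI:
  assumes x: "x \<in> space P"
    and "\<And>y. y \<in> space P \<Longrightarrow> (\<And>i. i \<in> window r \<Longrightarrow> y i = x i) \<Longrightarrow> \<psi> y = \<psi> x"
  shows "determined r x"
  unfolding determined_def
proof
  show "\<psi> x \<in> space MB" using measurable_space[OF \<psi> x] .
  show "AE z in P. \<psi> (resample r x z) = \<psi> x"
  proof (rule AE_I2)
    fix z assume "z \<in> space P"
    then have "resample r x z \<in> space P"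
      using x by (auto simp: space_PiM PiE_iff override_on_def)
    then show "\<psi> (resample r x z) = \<psi> x" by (rule assms(2)) simp
  qed
qed

end

section \<open>Codings on the lattice\<close>

text \<open>The balls of radius 1 / (n + 1) around a countable dense set separate points: once 2 /
  (n + 1) is below the distance of a and b, a ball of this kind that contains a misses b.\<close>

lemma polish_topology_separating:
  assumes "polish_topology T"
  obtains \<U> where "countable \<U>" "\<U> \<subseteq> sets (borel_of T)"
    "\<And>a b. a \<in> topspace T \<Longrightarrow> b \<in> topspace T \<Longrightarrow> (\<And>U. U \<in> \<U> \<Longrightarrow> a \<in> U \<longleftrightarrow> b \<in> U) \<Longrightarrow> a = b"
proof -
  obtain X d where "Metric_space X d" and T: "T = Metric_space.mtopology X d"
    using assms unfolding polish_topology_def completely_metrizable_space_def by blast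
  interpret Metric_space X d by fact
  obtain C where C: "countable C" "C \<subseteq> X" "T closure_of C = X"
    using assms unfolding polish_topology_def separable_space_def T by auto
  define \<U> where "\<U> = (\<lambda>(c, n). mball c (1 / Suc n)) ` (C \<times> UNIV)"
  show ?thesis
  proof
    show "countable \<U>" using C by (simp add: \<U>_def)
    show "\<U> \<subseteq> sets (borel_of T)"
      unfolding borel_of_def \<U>_def T
      by (subst sets_measure_of) (auto intro!: sigma_sets.Basic dest: openin_subset[THEN subsetD])
    fix a b assume ab: "a \<in> topspace T" "b \<in> topspace T" "\<And>U. U \<in> \<U> \<Longrightarrow> a \<in> U \<longleftrightarrow> b \<in> U"
    then have X: "a \<in> X" "b \<in> X" by (auto simp: T)
    show "a = b"
    proof (rule ccontr)
      assume "a \<noteq> b"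
      then have "0 < d a b / 2" using X by simp
      then obtain n where n: "1 / Suc n < d a b / 2" using nat_approx_posE by blast
      have "a \<in> T closure_of C" using X C by simp
      then obtain c where c: "c \<in> C" "c \<in> mball a (1 / Suc n)"
        unfolding T metric_closure_of by (auto dest!: spec[of _ "1 / Suc n"])
      then have "a \<in> mball c (1 / Suc n)" by (simp add: commute)
      moreover have "mball c (1 / Suc n) \<in> \<U>" using c by (auto simp: \<U>_def)
      ultimately have "b \<in> mball c (1 / Suc n)" using ab(3) by blast
      then have "d a b < 1 / Suc n + 1 / Suc n"
        using c triangle[of a c b] X by (auto simp: in_mball)
      then show False using n by simp
    qed
  qed
qed

section \<open>Oscillations of a local function\<close>

lemma abs_diff_le_osc:
  assumes "bounded_differences S f" "y \<in> configs S" "y' \<in> configs S" "\<And>i. i \<noteq> j \<Longrightarrow> y i = y' i"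
  shows "\<bar>f y - f y'\<bar> \<le> enn2real (osc S f j)"
proof -
  have "ennreal \<bar>f y - f y'\<bar> \<le> osc S f j"
    unfolding osc_def using assms(2-4) by (intro Sup_upper) blast
  moreover have "osc S f j < \<infinity>" using assms(1) by (simp add: bounded_differences_def)
  ultimately show ?thesis
    by (metis abs_ge_zero enn2real_ennreal enn2real_mono infinity_ennreal_def)
qed

text \<open>The coordinates in \<open>dep S f\<close> are changed from y to y' one at a time; those
  that already agree cost nothing. The final hybrid agrees with y' on \<open>dep S f\<close>, so
  locality gives it the value of f at y'.\<close>

lemma abs_diff_le_sum_osc:
  assumes bd: "bounded_differences S f" and loc: "local_fun S f"
    and y: "y \<in> configs S" and y': "y' \<in> configs S"
  shows "\<bar>f y - f y'\<bar> \<le> (\<Sum>j\<in>dep S f. if y j = y' j then 0 else enn2real (osc S f j))"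
proof -
  let ?s = "\<lambda>F. \<Sum>j\<in>F. if y j = y' j then 0 else enn2real (osc S f j)"
  have mem: "override_on y y' F \<in> configs S" for F
    using y y' by (auto simp: configs_def override_on_def Pi_iff)
  have "\<bar>f y - f (override_on y y' F)\<bar> \<le> ?s F" if "finite F" for F
    using that
  proof (induction F rule: finite_induct)
    case (insert i F)
    have "\<bar>f (override_on y y' F) - f (override_on y y' (insert i F))\<bar>
        \<le> (if y i = y' i then 0 else enn2real (osc S f i))"
    proof (cases "y i = y' i")
      case True
      then have "override_on y y' (insert i F) = override_on y y' F" by (auto simp: override_on_def)
      then show ?thesis using True by simp
    next
      case False
      moreover have "\<bar>f (override_on y y' F) - f (override_on y y' (insert i F))\<bar> \<le> enn2real (osc S f i)"
        by (rule abs_diff_le_osc[OF bd mem mem]) (simp add: override_on_def)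
      ultimately show ?thesis by simp
    qed
    then show ?case using insert by simp
  qed simp
  note this[of "dep S f"]
  moreover have "finite (dep S f)" and dep: "\<And>u v. u \<in> configs S \<Longrightarrow> v \<in> configs S \<Longrightarrow>
      (\<And>j. j \<in> dep S f \<Longrightarrow> u j = v j) \<Longrightarrow> f u = f v"
    using loc unfolding local_fun_def by blast+
  moreover have "f (override_on y y' (dep S f)) = f y'"
    by (rule dep[OF mem y']) simp
  ultimately show ?thesis by (simp only:)
qed

lemma osc_norm_sq_eq:
  assumes bd: "bounded_differences S f" and "local_fun S f"
  shows "osc_norm_sq S f = ennreal (\<Sum>j\<in>dep S f. (enn2real (osc S f j))\<^sup>2)"
proof -
  have fin: "finite (dep S f)" using assms by (simp add: local_fun_def)
  have "osc_norm_sq S f = (\<Sum>\<^sub>\<infinity>j\<in>dep S f. (osc S f j)\<^sup>2)"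
    unfolding osc_norm_sq_def by (rule infsum_cong_neutral) (auto simp: dep_def)
  also have "\<dots> = (\<Sum>j\<in>dep S f. (osc S f j)\<^sup>2)" using fin by simp
  also have "\<dots> = (\<Sum>j\<in>dep S f. ennreal ((enn2real (osc S f j))\<^sup>2))"
    using bd by (intro sum.cong refl) (simp add: bounded_differences_def flip: ennreal_power)
  finally show ?thesis by simp
qed

section \<open>Shifts and finite-range approximations of a coding\<close>

lemma measurable_shift: "shift j \<in> PiM UNIV (\<lambda>_. N) \<rightarrow>\<^sub>M PiM UNIV (\<lambda>_. N)"
proof (rule measurable_PiM_single')
  show "(\<lambda>x. shift j x i) \<in> PiM UNIV (\<lambda>_. N) \<rightarrow>\<^sub>M N" for i
    by (simp add: shift_def)
qed (auto simp: shift_def space_PiM PiE_iff)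

lemma distr_shift:
  assumes "prob_space N"
  shows "distr (PiM UNIV (\<lambda>_. N)) (PiM UNIV (\<lambda>_. N)) (shift j) = PiM UNIV (\<lambda>_. N)"
  using distr_PiM_reindex[of UNIV "\<lambda>_. N" "\<lambda>i. i + j" UNIV] assms
  by (simp add: shift_def[abs_def] restrict_UNIV)

locale lattice_resampling = resampling N MB \<psi> \<U> "\<lambda>r. sup_ball 0 (enat r)"
  for N :: "'a measure" and MB :: "'b measure"
    and \<psi> :: "(int ^ 'd::finite \<Rightarrow> 'a) \<Rightarrow> 'b" and \<U> :: "'b set set"
begin

lemma integral_shift:
  fixes h :: "(int ^ 'd \<Rightarrow> 'a) \<Rightarrow> real"
  assumes "h \<in> borel_measurable P"
  shows "(\<integral>x. h (shift j x) \<partial>P) = (\<integral>x. h x \<partial>P)"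
  using integral_distr[OF measurable_shift[of j N] assms] distr_shift[OF N.prob_space_axioms, of j] by simp

text \<open>A finite-range approximation of the coding: the value at j reads only the ball of radius
  \<open>n\<close> around j.\<close>

definition code_field :: "nat \<Rightarrow> 'b \<Rightarrow> ('d, 'a) config \<Rightarrow> ('d, 'b) config" where
  "code_field n b\<^sub>0 x = (\<lambda>j. truncated n b\<^sub>0 (shift j x))"

lemma measurable_code_field:
  assumes "b\<^sub>0 \<in> space MB"
  shows "code_field n b\<^sub>0 \<in> P \<rightarrow>\<^sub>M config_space MB"
  unfolding config_space_def
proof (rule measurable_PiM_single')
  show "(\<lambda>x. code_field n b\<^sub>0 x j) \<in> P \<rightarrow>\<^sub>M MB" for j
    unfolding code_field_def by (rule measurable_compose[OF measurable_shift measurable_truncated[OF assms]])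
qed (use truncated_in_space[OF assms] in \<open>auto simp: code_field_def\<close>)

lemma code_field_in_configs: "b\<^sub>0 \<in> space MB \<Longrightarrow> code_field n b\<^sub>0 x \<in> configs (space MB)"
  using truncated_in_space by (auto simp: code_field_def configs_def)

lemma
  assumes "\<And>i. i \<in> sup_ball j (enat (radius n (shift j x))) \<Longrightarrow> x i = y i"
  shows radius_shift_cong: "radius n (shift j x) = radius n (shift j y)"
    and code_field_cong: "code_field n b\<^sub>0 x j = code_field n b\<^sub>0 y j"
proof -
  have "shift j x i = shift j y i" if "i \<in> sup_ball 0 (enat (radius n (shift j x)))" for i
    using that by (auto simp: shift_def intro!: assms)
  then show "radius n (shift j x) = radius n (shift j y)" "code_field n b\<^sub>0 x j = code_field n b\<^sub>0 y j"
    unfolding code_field_def by (blast intro: radius_cong truncated_cong)+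
qed

section \<open>The exponential bound for the truncated coding\<close>

text \<open>The influence \<open>q i x\<close> collects the \<open>\<delta> j\<close> of those j
  whose ball, with the radius seen in x, contains i. The factor l^2 / 2 of the exponential
  inequality and the factor 2 * 2^d of the influence estimate combine to 2^d * l^2.\<close>

lemma ln_exp_code_field_le:
  fixes f :: "('d, 'b) config \<Rightarrow> real"
  assumes f: "f \<in> borel_measurable (config_space MB)" and b\<^sub>0: "b\<^sub>0 \<in> space MB"
    and D: "finite D" and \<delta>: "\<And>j. 0 \<le> \<delta> j" and l: "0 < l"
    and diff: "\<And>y y'. y \<in> configs (space MB) \<Longrightarrow> y' \<in> configs (space MB) \<Longrightarrow>
      \<bar>f y - f y'\<bar> \<le> (\<Sum>j\<in>D. if y j = y' j then 0 else \<delta> j)"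
  shows "ln (\<integral>x. exp (l * f (code_field n b\<^sub>0 x)) \<partial>P) \<le> l * (\<integral>x. f (code_field n b\<^sub>0 x) \<partial>P)
     + 2 ^ CARD('d) * l\<^sup>2 * (\<integral>x. (2 * real (radius n x) + 1) ^ (2 * CARD('d)) \<partial>P) * (\<Sum>j\<in>D. (\<delta> j)\<^sup>2)"
proof -
  define g where "g x = f (code_field n b\<^sub>0 x)" for x
  \<comment> \<open>Radii are capped at \<open>n\<close>, so \<open>W\<close> contains every ball
    read from a site of \<open>D\<close>.\<close>
  define W where "W = (\<Union>j\<in>D. sup_ball j (enat n))"
  define q where "q i x = (\<Sum>j\<in>D. \<delta> j * of_bool (i \<in> sup_ball j (enat (radius n (shift j x)))))" for i x
  \<comment> \<open>Comparison with the constant configuration \<open>b\<^sub>0\<close> bounds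
    \<open>f\<close> by \<open>K\<close>; the second summand makes \<open>K\<close> bound the
    influences too.\<close>
  define K where "K = \<bar>f (\<lambda>_. b\<^sub>0)\<bar> + (\<Sum>j\<in>D. \<delta> j)"
  have W: "finite W" using D by (auto simp: W_def)
  have ballW: "i \<in> W" if "j \<in> D" "i \<in> sup_ball j (enat (radius n (shift j x)))" for i j x
    using that radius_le[of n "shift j x"] by (auto simp: W_def intro: order_trans)
  have g[measurable]: "g \<in> borel_measurable P"
    unfolding g_def by (rule measurable_compose[OF measurable_code_field[OF b\<^sub>0] f])
  have r: "(\<lambda>x. radius n (shift j x)) \<in> P \<rightarrow>\<^sub>M count_space UNIV" for j
    by (rule measurable_compose[OF measurable_shift measurable_radius])
  have [measurable]: "(\<lambda>x. of_bool (i \<in> sup_ball j (enat (radius n (shift j x)))) :: real) \<in> borel_measurable P" for i j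
    by (rule measurable_compose[OF r]) simp
  have q[measurable]: "q i \<in> borel_measurable P" for i
    unfolding q_def[abs_def] by measurable
  have S: "0 \<le> (\<Sum>j\<in>D. \<delta> j)" by (intro sum_nonneg \<delta>)
  have q_nonneg: "0 \<le> q i x" for i x
    unfolding q_def by (intro sum_nonneg mult_nonneg_nonneg \<delta>) simp
  have q_le: "q i x \<le> (\<Sum>j\<in>D. \<delta> j)" for i x
    unfolding q_def using \<delta> by (intro sum_mono) simp
  have g_bd: "\<bar>g x\<bar> \<le> K" for x
  proof -
    have "\<bar>g x - f (\<lambda>_. b\<^sub>0)\<bar> \<le> (\<Sum>j\<in>D. if code_field n b\<^sub>0 x j = b\<^sub>0 then 0 else \<delta> j)"
      using b\<^sub>0 unfolding g_def by (intro diff code_field_in_configs) (auto simp: configs_def)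
    also have "\<dots> \<le> (\<Sum>j\<in>D. \<delta> j)" using \<delta> by (intro sum_mono) simp
    finally show ?thesis unfolding K_def by linarith
  qed
  have g_le: "g y \<le> g x + (\<Sum>i\<in>W. if x i = y i then 0 else q i x)" for x y
  proof -
    have term_le: "(if code_field n b\<^sub>0 y j = code_field n b\<^sub>0 x j then 0 else \<delta> j)
        \<le> (\<Sum>i\<in>W. if x i = y i then 0 else \<delta> j * of_bool (i \<in> sup_ball j (enat (radius n (shift j x)))))"
      (is "_ \<le> sum ?h W") if j: "j \<in> D" for j
    proof (cases "code_field n b\<^sub>0 x j = code_field n b\<^sub>0 y j")
      case True
      then show ?thesis using \<delta> by (auto intro!: sum_nonneg)
    next
      case False
      \<comment> \<open>If the values at j differ, x and y must differ at some site of the ball read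
        in x, and the term of that site already pays \<open>\<delta> j\<close>.\<close>
      then obtain i where i: "i \<in> sup_ball j (enat (radius n (shift j x)))" "x i \<noteq> y i"
        using code_field_cong[of j n x y] by blast
      then have "\<delta> j = ?h i" by simp
      also have "\<dots> \<le> sum ?h W"
        using i ballW[OF j] W \<delta> by (intro member_le_sum) auto
      finally show ?thesis using False by simp
    qed
    have "g y - g x \<le> (\<Sum>j\<in>D. if code_field n b\<^sub>0 y j = code_field n b\<^sub>0 x j then 0 else \<delta> j)"
      unfolding g_def by (intro order_trans[OF abs_ge_self diff] code_field_in_configs b\<^sub>0)
    also have "\<dots> \<le> (\<Sum>j\<in>D. \<Sum>i\<in>W. if x i = y i then 0
        else \<delta> j * of_bool (i \<in> sup_ball j (enat (radius n (shift j x)))))"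
      by (intro sum_mono term_le)
    also have "\<dots> = (\<Sum>i\<in>W. if x i = y i then 0 else q i x)"
      unfolding q_def by (subst sum.swap) (auto intro!: sum.cong)
    finally show ?thesis by simp
  qed
  \<comment> \<open>Agreement on \<open>W\<close> forces equal radii and equal values at all sites
    of \<open>D\<close>; by \<open>diff\<close> the two values of \<open>g\<close> then
    coincide.\<close>
  have loc: "g x = g y \<and> (\<forall>i. q i x = q i y)" if "\<And>i. i \<in> W \<Longrightarrow> x i = y i" for x y
  proof -
    have "radius n (shift j x) = radius n (shift j y)" if "j \<in> D" for j
      using \<open>\<And>i. i \<in> W \<Longrightarrow> x i = y i\<close> ballW[OF that] by (intro radius_shift_cong) blast
    moreover have code: "code_field n b\<^sub>0 x j = code_field n b\<^sub>0 y j" if "j \<in> D" for j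
      using \<open>\<And>i. i \<in> W \<Longrightarrow> x i = y i\<close> ballW[OF that] by (intro code_field_cong) blast
    moreover have "\<bar>g x - g y\<bar> \<le> (\<Sum>j\<in>D. if code_field n b\<^sub>0 x j = code_field n b\<^sub>0 y j then 0 else \<delta> j)"
      unfolding g_def by (intro diff code_field_in_configs b\<^sub>0)
    moreover have "\<dots> = 0" using code by (intro sum.neutral) simp
    ultimately show ?thesis by (simp add: q_def)
  qed
  have lK: "l * (\<Sum>j\<in>D. \<delta> j) \<le> l * K" using l by (simp add: K_def)
  have "ln (\<integral>x. exp (l * g x) \<partial>P) \<le> (\<integral>x. l * g x + (\<Sum>i\<in>W. (l * q i x)\<^sup>2) / 2 \<partial>P)"
  proof (rule ln_exp_integral_PiM_UNIV_le[where k = "l * K", OF W N.prob_space_axioms])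
    show "(\<lambda>x. l * g x) \<in> borel_measurable P" "(\<lambda>x. l * q i x) \<in> borel_measurable P" for i by measurable
    show "\<bar>l * g x\<bar> \<le> l * K" for x using l g_bd[of x] by (simp add: abs_mult)
    show "0 \<le> l * q i x" for i x using l q_nonneg by simp
    show "l * q i x \<le> l * K" for i x
      using l q_le[of i x] by (intro order_trans[OF _ lK] mult_left_mono) auto
    show "l * g x = l * g y" "l * q i x = l * q i y" if "\<And>i. i \<in> W \<Longrightarrow> x i = y i" for i x y
      using loc[OF that] by simp_all
    fix x y
    have "(\<Sum>i\<in>W. if x i = y i then 0 else l * q i x) = l * (\<Sum>i\<in>W. if x i = y i then 0 else q i x)"
      by (auto simp: sum_distrib_left intro!: sum.cong)
    then show "l * g y \<le> l * g x + (\<Sum>i\<in>W. if x i = y i then 0 else l * q i x)"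
      using mult_left_mono[OF g_le[of y x], of l] l by (simp add: distrib_left)
  qed
  also have "\<dots> = l * (\<integral>x. g x \<partial>P) + l\<^sup>2 / 2 * (\<integral>x. (\<Sum>i\<in>W. (q i x)\<^sup>2) \<partial>P)"
  proof -
    have "integrable P g" using g_bd by (intro P.integrable_const_bound[where B = K]) auto
    moreover have "integrable P (\<lambda>x. (q i x)\<^sup>2)" for i
      using q_nonneg q_le by (intro P.integrable_const_bound[where B = "(\<Sum>j\<in>D. \<delta> j)\<^sup>2"])
        (auto intro!: power_mono)
    moreover have "(\<Sum>i\<in>W. (l * q i x)\<^sup>2) / 2 = l\<^sup>2 / 2 * (\<Sum>i\<in>W. (q i x)\<^sup>2)" for x
      by (simp add: power_mult_distrib sum_distrib_left sum_divide_distrib)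
    ultimately show ?thesis by simp
  qed
  finally have main: "ln (\<integral>x. exp (l * g x) \<partial>P)
      \<le> l * (\<integral>x. g x \<partial>P) + l\<^sup>2 / 2 * (\<integral>x. (\<Sum>i\<in>W. (q i x)\<^sup>2) \<partial>P)" .
  \<comment> \<open>\<open>shift 0\<close> is the identity; it is kept here so that the radius at
    the origin is the member j = 0 of the family.\<close>
  have "(\<integral>x. (\<Sum>i\<in>W. (q i x)\<^sup>2) \<partial>P)
      \<le> 2 * 2 ^ CARD('d) * (\<integral>x. (2 * real (radius n (shift 0 x)) + 1) ^ (2 * CARD('d)) \<partial>P) * (\<Sum>j\<in>D. (\<delta> j)\<^sup>2)"
    unfolding q_def
  proof (rule P.integral_sum_power2_influence_le[OF D W \<delta> r radius_le])
    fix j and h :: "nat \<Rightarrow> real"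
    have h: "(\<lambda>x. h (radius n x)) \<in> borel_measurable P"
      by (rule measurable_compose[OF measurable_radius]) simp
    show "(\<integral>x. h (radius n (shift j x)) \<partial>P) = (\<integral>x. h (radius n (shift 0 x)) \<partial>P)"
      by (simp only: integral_shift[OF h])
  qed
  then have "l\<^sup>2 / 2 * (\<integral>x. (\<Sum>i\<in>W. (q i x)\<^sup>2) \<partial>P)
      \<le> l\<^sup>2 / 2 * (2 * 2 ^ CARD('d) * (\<integral>x. (2 * real (radius n (shift 0 x)) + 1) ^ (2 * CARD('d)) \<partial>P)
        * (\<Sum>j\<in>D. (\<delta> j)\<^sup>2))"
    by (rule mult_left_mono) simp
  also have "\<dots> = 2 ^ CARD('d) * l\<^sup>2 * (\<integral>x. (2 * real (radius n x) + 1) ^ (2 * CARD('d)) \<partial>P) * (\<Sum>j\<in>D. (\<delta> j)\<^sup>2)"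
    by (simp add: shift_def)
  finally show ?thesis using main unfolding g_def by linarith
qed

end

section \<open>Removing the truncation\<close>

text \<open>Almost surely the truncated coding eventually agrees with \<open>\<phi>\<close> on the
  finite set \<open>D\<close>, so \<open>f\<close> eventually takes the same value on both, and
  dominated convergence applies. The error term enters through a bound \<open>z\<close> uniform in
  n.\<close>

lemma (in lattice_resampling) ln_exp_le_of_AE_determined:
  fixes f :: "('d, 'b) config \<Rightarrow> real" and \<phi> :: "('d, 'a) config \<Rightarrow> ('d, 'b) config"
  assumes f: "f \<in> borel_measurable (config_space MB)"
    and D: "finite D" and \<delta>: "\<And>j. 0 \<le> \<delta> j" and l: "0 < l"
    and diff: "\<And>y y'. y \<in> configs (space MB) \<Longrightarrow> y' \<in> configs (space MB) \<Longrightarrow>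
      \<bar>f y - f y'\<bar> \<le> (\<Sum>j\<in>D. if y j = y' j then 0 else \<delta> j)"
    and \<phi>: "\<phi> \<in> P \<rightarrow>\<^sub>M config_space MB"
    and \<phi>_shift: "\<And>x j. x \<in> space P \<Longrightarrow> \<phi> x j = \<psi> (shift j x)"
    and det: "AE x in P. \<exists>r. determined r x"
    and z: "\<And>n. 2 ^ CARD('d) * l\<^sup>2 * (\<integral>x. (2 * real (radius n x) + 1) ^ (2 * CARD('d)) \<partial>P)
      * (\<Sum>j\<in>D. (\<delta> j)\<^sup>2) \<le> z"
  shows "ln (\<integral>x. exp (l * f (\<phi> x)) \<partial>P) \<le> l * (\<integral>x. f (\<phi> x) \<partial>P) + z"
    and "0 < (\<integral>x. exp (l * f (\<phi> x)) \<partial>P)"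
proof -
  obtain x\<^sub>0 where x\<^sub>0: "x\<^sub>0 \<in> space P" using P.not_empty by blast
  \<comment> \<open>The default may be any point of \<open>MB\<close>; the value of
    \<open>\<psi>\<close> at some configuration shows that there is one.\<close>
  define b\<^sub>0 where "b\<^sub>0 = \<psi> x\<^sub>0"
  have b\<^sub>0: "b\<^sub>0 \<in> space MB" unfolding b\<^sub>0_def by (rule measurable_space[OF \<psi> x\<^sub>0])
  define K where "K = \<bar>f (\<lambda>_. b\<^sub>0)\<bar> + (\<Sum>j\<in>D. \<delta> j)"
  have f_bd: "\<bar>f y\<bar> \<le> K" if y: "y \<in> configs (space MB)" for y
  proof -
    have "\<bar>f y - f (\<lambda>_. b\<^sub>0)\<bar> \<le> (\<Sum>j\<in>D. if y j = b\<^sub>0 then 0 else \<delta> j)"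
      using b\<^sub>0 y by (intro diff) (auto simp: configs_def)
    also have "\<dots> \<le> (\<Sum>j\<in>D. \<delta> j)" using \<delta> by (intro sum_mono) simp
    finally show ?thesis unfolding K_def by linarith
  qed
  have \<phi>_mem: "\<phi> x \<in> configs (space MB)" if "x \<in> space P" for x
    using measurable_space[OF \<phi> that] by (auto simp: config_space_def configs_def space_PiM PiE_iff)
  have fcode[measurable]: "(\<lambda>x. f (code_field n b\<^sub>0 x)) \<in> borel_measurable P" for n
    by (rule measurable_compose[OF measurable_code_field[OF b\<^sub>0] f])
  have f\<phi>[measurable]: "(\<lambda>x. f (\<phi> x)) \<in> borel_measurable P"
    by (rule measurable_compose[OF \<phi> f])
  have AE_shift: "AE x in P. Q (shift j x)" if "AE x in P. Q x" for Q j
  proof -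
    have "AE x in distr P P (shift j). Q x"
      unfolding distr_shift[OF N.prob_space_axioms] by (rule that)
    then show ?thesis by (rule AE_distrD[OF measurable_shift])
  qed
  have ev: "AE x in P. \<forall>\<^sub>F n in sequentially. code_field n b\<^sub>0 x j = \<phi> x j" for j
  proof -
    have "AE x in P. \<forall>n. (\<exists>r\<le>n. determined r x) \<longrightarrow> truncated n b\<^sub>0 x = \<psi> x"
      by (simp add: AE_all_countable AE_truncated_eq)
    with det have "AE x in P. \<forall>\<^sub>F n in sequentially. truncated n b\<^sub>0 x = \<psi> x"
      by eventually_elim (auto simp: eventually_sequentially)
    from AE_shift[OF this, of j] AE_space show ?thesis
      by eventually_elim (simp add: code_field_def \<phi>_shift)
  qed
  \<comment> \<open>The lattice is countable, so one null set serves all sites.\<close>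
  have "AE x in P. \<forall>j. \<forall>\<^sub>F n in sequentially. code_field n b\<^sub>0 x j = \<phi> x j"
    by (simp add: AE_all_countable ev)
  then have lim: "AE x in P. (\<lambda>n. f (code_field n b\<^sub>0 x)) \<longlonglongrightarrow> f (\<phi> x)"
    using AE_space
  proof eventually_elim
    case (elim x)
    have "\<forall>\<^sub>F n in sequentially. \<forall>j\<in>D. code_field n b\<^sub>0 x j = \<phi> x j"
      using elim(1) by (intro eventually_ball_finite D) blast
    then have "\<forall>\<^sub>F n in sequentially. f (code_field n b\<^sub>0 x) = f (\<phi> x)"
    proof eventually_elim
      case (elim n)
      have "\<bar>f (code_field n b\<^sub>0 x) - f (\<phi> x)\<bar> \<le> (\<Sum>j\<in>D. if code_field n b\<^sub>0 x j = \<phi> x j then 0 else \<delta> j)"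
        by (intro diff code_field_in_configs b\<^sub>0 \<phi>_mem \<open>x \<in> space P\<close>)
      also have "\<dots> = 0" using elim by (intro sum.neutral) simp
      finally show ?case by simp
    qed
    then show ?case by (rule tendsto_eventually)
  qed
  have lim_int: "(\<lambda>n. \<integral>x. f (code_field n b\<^sub>0 x) \<partial>P) \<longlonglongrightarrow> (\<integral>x. f (\<phi> x) \<partial>P)"
    using f_bd[OF code_field_in_configs[OF b\<^sub>0]]
    by (intro integral_dominated_convergence[where w = "\<lambda>_. K"] lim) auto
  have lim_exp: "(\<lambda>n. \<integral>x. exp (l * f (code_field n b\<^sub>0 x)) \<partial>P) \<longlonglongrightarrow> (\<integral>x. exp (l * f (\<phi> x)) \<partial>P)"
  proof (rule integral_dominated_convergence[where w = "\<lambda>_. exp (l * K)"])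
    show "AE x in P. (\<lambda>n. exp (l * f (code_field n b\<^sub>0 x))) \<longlonglongrightarrow> exp (l * f (\<phi> x))"
      using lim by eventually_elim (intro tendsto_intros)
    show "AE x in P. norm (exp (l * f (code_field n b\<^sub>0 x))) \<le> exp (l * K)" for n
      using f_bd[OF code_field_in_configs[OF b\<^sub>0], THEN abs_le_D1] l by auto
  qed auto
  show pos: "0 < (\<integral>x. exp (l * f (\<phi> x)) \<partial>P)"
    using f_bd[OF \<phi>_mem] l by (intro P.ln_exp_integral_bounds(1)[where k = "l * K"]) (auto simp: abs_mult)
  \<comment> \<open>The limit of the exponential integrals is positive, so \<open>ln\<close> is
    continuous there.\<close>
  have "(\<lambda>n. ln (\<integral>x. exp (l * f (code_field n b\<^sub>0 x)) \<partial>P) - l * (\<integral>x. f (code_field n b\<^sub>0 x) \<partial>P))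
      \<longlonglongrightarrow> ln (\<integral>x. exp (l * f (\<phi> x)) \<partial>P) - l * (\<integral>x. f (\<phi> x) \<partial>P)"
    using pos by (intro tendsto_intros lim_int lim_exp) simp
  moreover have "ln (\<integral>x. exp (l * f (code_field n b\<^sub>0 x)) \<partial>P) - l * (\<integral>x. f (code_field n b\<^sub>0 x) \<partial>P) \<le> z" for n
    using ln_exp_code_field_le[OF f b\<^sub>0 D \<delta> l diff, of n] z[of n] by linarith
  ultimately have "ln (\<integral>x. exp (l * f (\<phi> x)) \<partial>P) - l * (\<integral>x. f (\<phi> x) \<partial>P) \<le> z"
    by (intro LIMSEQ_le_const2) auto
  then show "ln (\<integral>x. exp (l * f (\<phi> x)) \<partial>P) \<le> l * (\<integral>x. f (\<phi> x) \<partial>P) + z" by simp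
qed

section \<open>The law of the field and the final estimate\<close>

lemma space_borel_of [simp]: "space (borel_of T) = topspace T"
  unfolding borel_of_def by (rule space_measure_of) (auto dest: openin_subset[THEN subsetD])

lemma space_PiM_eq_configs: "space (PiM UNIV (\<lambda>_. N)) = configs (space N)"
  by (auto simp: space_PiM configs_def)

text \<open>Independence says that the joint law is the product of the marginals, and all marginals
  equal that of \<open>X 0\<close>.\<close>

lemma iid_field_distr:
  fixes X :: "int ^ 'd::finite \<Rightarrow> 'w \<Rightarrow> 'a"
  assumes "iid_field M MA X"
  shows "prob_space (distr M MA (X 0))"
    and "realization X \<in> M \<rightarrow>\<^sub>M PiM UNIV (\<lambda>_. distr M MA (X 0))"
    and "distr M (PiM UNIV (\<lambda>_. distr M MA (X 0))) (realization X) = PiM UNIV (\<lambda>_. distr M MA (X 0))"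
proof -
  interpret prob_space M using assms by (simp add: iid_field_def)
  have X: "X i \<in> M \<rightarrow>\<^sub>M MA" for i using assms by (simp add: iid_field_def indep_vars_def)
  have sets_eq: "sets (PiM UNIV (\<lambda>_::int ^ 'd. distr M MA (X 0))) = sets (PiM UNIV (\<lambda>_. MA))"
    by (intro sets_PiM_cong) simp_all
  show "prob_space (distr M MA (X 0))" by (rule prob_space_distr[OF X])
  have R: "realization X \<in> M \<rightarrow>\<^sub>M PiM UNIV (\<lambda>_. MA)"
    by (rule measurable_PiM_single')
      (use X measurable_space[OF X] in \<open>auto simp: realization_def[abs_def]\<close>)
  then show "realization X \<in> M \<rightarrow>\<^sub>M PiM UNIV (\<lambda>_. distr M MA (X 0))"
    using measurable_cong_sets[OF refl sets_eq] by blast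
  have "indep_vars (\<lambda>_. MA) X UNIV" using assms by (simp add: iid_field_def)
  then have "distr M (PiM UNIV (\<lambda>_. MA)) (\<lambda>x. \<lambda>i\<in>UNIV. X i x) = PiM UNIV (\<lambda>i. distr M MA (X i))"
    using X by (subst (asm) indep_vars_iff_distr_eq_PiM) auto
  moreover have "(\<lambda>i. distr M MA (X i)) = (\<lambda>_. distr M MA (X 0))"
    using assms by (auto simp: iid_field_def)
  ultimately show "distr M (PiM UNIV (\<lambda>_. distr M MA (X 0))) (realization X) = PiM UNIV (\<lambda>_. distr M MA (X 0))"
    using distr_cong[OF refl sets_eq refl, of M "realization X"]
    by (simp add: realization_def[abs_def] restrict_UNIV)
qed

theorem theorem3p1:
  fixes M :: "'w measure"
    and MA :: "'a measure"
    and TB :: "'b topology"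
    and X :: "int ^ 'd::finite \<Rightarrow> 'w \<Rightarrow> 'a"
    and Y :: "'w \<Rightarrow> ('d, 'b) config"
    and \<phi> :: "('d, 'a) config \<Rightarrow> ('d, 'b) config"
    and f :: "('d, 'b) config \<Rightarrow> real"
    and l :: real
  assumes "standard_borel MA"
    and "polish_topology TB"
    and "iid_field M MA X"
    and "coding_map MA (borel_of TB) \<phi>"
    and "finitary M MA X \<phi>"
    and "Y = (\<lambda>\<omega>. \<phi> (realization X \<omega>))"
    and "(\<integral>\<^sup>+ \<omega>. (coding_volume MA \<phi> (realization X \<omega>))\<^sup>2 \<partial>M) < \<infinity>"
    and "f \<in> borel_measurable (config_space (borel_of TB))"
    and "continuous_map (product_topology (\<lambda>_. TB) UNIV) euclideanreal f"
    and "local_fun (topspace TB) f"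
    and "bounded_differences (topspace TB) f"
    and "l > 0"
  shows "ereal (ln (\<integral>\<omega>. exp (l * (f (Y \<omega>) - (\<integral>\<omega>'. f (Y \<omega>') \<partial>M))) \<partial>M))
     \<le> enn2ereal (2 ^ CARD('d) * ennreal (l\<^sup>2)
          * (\<integral>\<^sup>+ \<omega>. (2 * ennreal_of_enat (coding_radius MA \<phi> (realization X \<omega>)) + 1) ^ (2 * CARD('d)) \<partial>M)
          * osc_norm_sq (topspace TB) f)"
    (is "_ \<le> enn2ereal ?Z")
proof -
  note iid = iid_field_distr[OF assms(3)]
  \<comment> \<open>The argument takes place on the product space with marginal \<open>N\<close>;
    \<open>law\<close> transfers integrals and almost sure statements to and from
    \<open>M\<close>.\<close>
  define N where "N = distr M MA (X 0)"
  define \<psi> where "\<psi> x = \<phi> x 0" for x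
  define D where "D = dep (topspace TB) f"
  define \<delta> where "\<delta> j = enn2real (osc (topspace TB) f j)" for j
  let ?MB = "borel_of TB"
  let ?P = "PiM UNIV (\<lambda>_::int ^ 'd. N)"
  let ?R = "realization X"
  have N: "prob_space N" unfolding N_def by (rule iid(1))
  have R[measurable]: "?R \<in> M \<rightarrow>\<^sub>M ?P" unfolding N_def by (rule iid(2))
  have law: "distr M ?P ?R = ?P" unfolding N_def by (rule iid(3))
  have space_P: "space ?P = configs (space MA)" by (simp add: space_PiM_eq_configs N_def)
  have sets_P: "sets ?P = sets (config_space MA)"
    unfolding config_space_def N_def by (intro sets_PiM_cong) simp_all
  have \<phi>: "\<phi> \<in> ?P \<rightarrow>\<^sub>M config_space ?MB"
    using assms(4) measurable_cong_sets[OF sets_P refl] by (auto simp: coding_map_def)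
  have \<psi>: "\<psi> \<in> ?P \<rightarrow>\<^sub>M ?MB"
    unfolding \<psi>_def[abs_def]
    using measurable_compose[OF \<phi>[unfolded config_space_def] measurable_component_singleton[of 0]] by simp
  obtain \<U> where \<U>: "countable \<U>" "\<U> \<subseteq> sets ?MB"
    "\<And>a b. a \<in> topspace TB \<Longrightarrow> b \<in> topspace TB \<Longrightarrow> (\<And>U. U \<in> \<U> \<Longrightarrow> a \<in> U \<longleftrightarrow> b \<in> U) \<Longrightarrow> a = b"
    using polish_topology_separating[OF assms(2)] by blast
  have mono_ball: "mono (\<lambda>r. sup_ball (0 :: int ^ 'd) (enat r))"
    by (auto simp: mono_def sup_ball_def intro: order_trans)
  interpret L: lattice_resampling N ?MB \<psi> \<U>
  proof (intro lattice_resampling.intro resampling.intro resampling_axioms.intro N \<psi> \<U>(1,2) mono_ball)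
    fix a b assume "a \<in> space ?MB" "b \<in> space ?MB" "\<And>U. U \<in> \<U> \<Longrightarrow> a \<in> U \<longleftrightarrow> b \<in> U"
    then show "a = b" by (intro \<U>(3)) simp_all
  qed
  have det: "L.determined r x"
    if x: "x \<in> configs (space MA)"
      and r: "\<forall>x' \<in> configs (space MA). (\<forall>i \<in> sup_ball 0 (enat r). x' i = x i) \<longrightarrow> \<phi> x' 0 = \<phi> x 0"
    for r x
  proof (rule L.determinedI)
    show "x \<in> space ?P" using x space_P by simp
    fix y assume "y \<in> space ?P" "\<And>i. i \<in> sup_ball 0 (enat r) \<Longrightarrow> y i = x i"
    then show "\<psi> y = \<psi> x" using r unfolding \<psi>_def space_P by blast
  qed
  \<comment> \<open>Every r admissible in the coding radius is \<open>determined\<close>, so the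
    measurable radius is a lower bound of the set whose infimum is taken.\<close>
  have radius_le: "enat (L.radius n x) \<le> coding_radius MA \<phi> x" if "x \<in> configs (space MA)" for n x
    unfolding coding_radius_def
  proof (rule Inf_greatest)
    fix e assume "e \<in> {enat r |r. \<forall>x' \<in> configs (space MA).
      (\<forall>i \<in> sup_ball 0 (enat r). x' i = x i) \<longrightarrow> \<phi> x' 0 = \<phi> x 0}"
    then obtain r where "e = enat r"
        "\<forall>x' \<in> configs (space MA). (\<forall>i \<in> sup_ball 0 (enat r). x' i = x i) \<longrightarrow> \<phi> x' 0 = \<phi> x 0"
      by blast
    then show "enat (L.radius n x) \<le> e" using L.radius_le_determined[OF det[OF that]] by simp
  qed
  have "AE \<omega> in M. \<exists>r. L.determined r (?R \<omega>)"
    using assms(5) AE_space unfolding finitary_def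
  proof eventually_elim
    case (elim \<omega>)
    then have "?R \<omega> \<in> configs (space MA)" using measurable_space[OF R] space_P by blast
    \<comment> \<open>A finite coding radius means that some r is admissible, because the infimum of
      the empty set is infinite.\<close>
    moreover have "{enat r |r. \<forall>x' \<in> configs (space MA). (\<forall>i \<in> sup_ball 0 (enat r). x' i = ?R \<omega> i)
        \<longrightarrow> \<phi> x' 0 = \<phi> (?R \<omega>) 0} \<noteq> {}"
    proof
      assume "{enat r |r. \<forall>x' \<in> configs (space MA). (\<forall>i \<in> sup_ball 0 (enat r). x' i = ?R \<omega> i)
        \<longrightarrow> \<phi> x' 0 = \<phi> (?R \<omega>) 0} = {}"
      then have "coding_radius MA \<phi> (?R \<omega>) = \<infinity>"
        unfolding coding_radius_def by (simp only: Inf_empty top_enat_def)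
      then show False using elim(1) by simp
    qed
    ultimately show ?case using det by blast
  qed
  then have AE_det: "AE x in ?P. \<exists>r. L.determined r x"
    by (subst law[symmetric], subst AE_distr_iff) (auto intro: R)
  have Z_ge: "ennreal (2 ^ CARD('d) * l\<^sup>2 * (\<integral>x. (2 * real (L.radius n x) + 1) ^ (2 * CARD('d)) \<partial>?P)
      * (\<Sum>j\<in>D. (\<delta> j)\<^sup>2)) \<le> ?Z" (is "ennreal (_ * ?q * _) \<le> _") for n
  proof -
    have rad[measurable]: "(\<lambda>x. (2 * real (L.radius n x) + 1) ^ (2 * CARD('d))) \<in> borel_measurable ?P"
      by (rule measurable_compose[OF L.measurable_radius]) simp
    have "ennreal ?q = (\<integral>\<^sup>+x. ennreal ((2 * real (L.radius n x) + 1) ^ (2 * CARD('d))) \<partial>?P)"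
      using L.radius_le[of n]
      by (intro nn_integral_eq_integral[symmetric] AE_I2
          L.P.integrable_const_bound[where B = "(2 * real n + 1) ^ (2 * CARD('d))"])
        (auto intro!: power_mono)
    also have "\<dots> = (\<integral>\<^sup>+\<omega>. ennreal ((2 * real (L.radius n (?R \<omega>)) + 1) ^ (2 * CARD('d))) \<partial>M)"
      by (subst law[symmetric], subst nn_integral_distr) auto
    \<comment> \<open>Monotonicity of the lower integral holds for arbitrary integrands, so the
      comparison is valid even where the coding radius is not measurable.\<close>
    also have "\<dots> \<le> (\<integral>\<^sup>+ \<omega>. (2 * ennreal_of_enat (coding_radius MA \<phi> (?R \<omega>)) + 1) ^ (2 * CARD('d)) \<partial>M)"
    proof (rule nn_integral_mono)
      fix \<omega> assume "\<omega> \<in> space M"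
      then have "?R \<omega> \<in> configs (space MA)" using measurable_space[OF R] space_P by blast
      then have "ennreal_of_enat (enat (L.radius n (?R \<omega>))) \<le> ennreal_of_enat (coding_radius MA \<phi> (?R \<omega>))"
        using radius_le by (simp only: ennreal_of_enat_le_iff)
      then have "(2 * of_nat (L.radius n (?R \<omega>)) + 1) ^ (2 * CARD('d))
          \<le> (2 * ennreal_of_enat (coding_radius MA \<phi> (?R \<omega>)) + 1) ^ (2 * CARD('d))"
        by (intro power_mono add_mono mult_left_mono) auto
      moreover have "ennreal ((2 * real (L.radius n (?R \<omega>)) + 1) ^ (2 * CARD('d)))
          = (2 * of_nat (L.radius n (?R \<omega>)) + 1) ^ (2 * CARD('d))"
        by (simp add: ennreal_power[symmetric] ennreal_plus ennreal_mult ennreal_of_nat_eq_real_of_nat)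
      ultimately show "ennreal ((2 * real (L.radius n (?R \<omega>)) + 1) ^ (2 * CARD('d)))
          \<le> (2 * ennreal_of_enat (coding_radius MA \<phi> (?R \<omega>)) + 1) ^ (2 * CARD('d))" by simp
    qed
    finally have q: "ennreal ?q \<le> (\<integral>\<^sup>+ \<omega>. (2 * ennreal_of_enat (coding_radius MA \<phi> (?R \<omega>)) + 1) ^ (2 * CARD('d)) \<partial>M)" .
    have "0 \<le> ?q" by (intro integral_nonneg_AE) simp
    then have "ennreal (2 ^ CARD('d) * l\<^sup>2 * ?q * (\<Sum>j\<in>D. (\<delta> j)\<^sup>2))
        = 2 ^ CARD('d) * ennreal (l\<^sup>2) * ennreal ?q * osc_norm_sq (topspace TB) f"
      unfolding osc_norm_sq_eq[OF assms(11,10)] D_def \<delta>_def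
      by (simp add: ennreal_mult sum_nonneg flip: ennreal_power)
    also have "\<dots> \<le> ?Z" by (intro mult_right_mono mult_left_mono q) auto
    finally show ?thesis .
  qed
  show ?thesis
  \<comment> \<open>An infinite right-hand side leaves nothing to prove; a finite one supplies the
    real bound \<open>z\<close>, uniform in n.\<close>
  proof (cases "?Z = \<infinity>")
    case True
    then show ?thesis by simp
  next
    case False
    then obtain z where z: "0 \<le> z" "?Z = ennreal z" by (cases ?Z) auto
    have bound: "2 ^ CARD('d) * l\<^sup>2 * (\<integral>x. (2 * real (L.radius n x) + 1) ^ (2 * CARD('d)) \<partial>?P)
      * (\<Sum>j\<in>D. (\<delta> j)\<^sup>2) \<le> z" for n
      using Z_ge[of n] z by (simp add: ennreal_le_iff)
    have D: "finite D" using assms(10) by (simp add: D_def local_fun_def)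
    have \<delta>: "0 \<le> \<delta> j" for j by (simp add: \<delta>_def)
    have diff: "\<bar>f y - f y'\<bar> \<le> (\<Sum>j\<in>D. if y j = y' j then 0 else \<delta> j)"
      if "y \<in> configs (space ?MB)" "y' \<in> configs (space ?MB)" for y y'
      unfolding D_def \<delta>_def using that by (intro abs_diff_le_sum_osc assms(10,11)) simp_all
    \<comment> \<open>By equivariance the value at j is the value at the origin after shifting by
      j.\<close>
    have \<phi>_shift: "\<phi> x j = \<psi> (shift j x)" if "x \<in> space ?P" for x j
      using assms(4) that by (simp add: coding_map_def space_P \<psi>_def) (simp add: shift_def)
    note main = L.ln_exp_le_of_AE_determined(1)[OF assms(8) D \<delta> assms(12) diff \<phi> \<phi>_shift AE_det bound]
    note pos = L.ln_exp_le_of_AE_determined(2)[OF assms(8) D \<delta> assms(12) diff \<phi> \<phi>_shift AE_det bound]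
    have f\<phi>: "(\<lambda>x. f (\<phi> x)) \<in> borel_measurable ?P" by (rule measurable_compose[OF \<phi> assms(8)])
    define m where "m = (\<integral>x. f (\<phi> x) \<partial>?P)"
    have mY: "(\<integral>\<omega>. f (Y \<omega>) \<partial>M) = m"
      unfolding assms(6) m_def by (subst law[symmetric], subst integral_distr) (use R f\<phi> in auto)
    \<comment> \<open>Centring multiplies the exponential integral by exp (- l m), so it subtracts l
      m from the logarithm.\<close>
    have "(\<integral>\<omega>. exp (l * (f (Y \<omega>) - m)) \<partial>M) = exp (- (l * m)) * (\<integral>\<omega>. exp (l * f (Y \<omega>)) \<partial>M)"
      by (subst integral_mult_right_zero[symmetric]) (simp add: right_diff_distrib exp_diff exp_minus field_simps)
    also have "(\<integral>\<omega>. exp (l * f (Y \<omega>)) \<partial>M) = (\<integral>x. exp (l * f (\<phi> x)) \<partial>?P)"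
      unfolding assms(6) by (subst law[symmetric], subst integral_distr) (use R f\<phi> in auto)
    finally have "ln (\<integral>\<omega>. exp (l * (f (Y \<omega>) - m)) \<partial>M) = - (l * m) + ln (\<integral>x. exp (l * f (\<phi> x)) \<partial>?P)"
      using pos by (simp add: ln_mult)
    also have "\<dots> \<le> z" using main by (simp add: m_def)
    finally show ?thesis using z by (simp add: mY enn2ereal_ennreal)
  qed
qed

end
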